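(* Let $\Omega\subset\mathbb{R}^N$ ($N\le 3$) be a smooth bounded domain whose principal Dirichlet eigenvalue $\Lambda_1$ of $-\Delta$ satisfies $\Lambda_1<1$, let $n\ge 3$ and $\mu_1\le\mu_2\le\dots\le\mu_n$ be real constants, and consider, for $\beta\in\mathbb{R}$, the system $$-\Delta u_j-u_j=\mu_ju_j^3+\beta\sum_{k\ne j}u_k^2u_j,\quad u_j>0 \text{ in }\Omega,\quad u_j=0\text{ on }\partial\Omega,\qquad j=1,\dots,n.$$ Define the interval (or union of intervals) $I$ by: $I=(-\infty,\bar\beta)$ in the focusing case; $I=(-\infty,\mu_1)\cup(\mu_n,\bar\beta)$ in the defocusing case; $I=(-\infty,\mu_1)$ in all mixed cases. Then for every $\beta\in I$ the system has a synchronized solution $\mathbf u(\beta)=(u_1,\dots,u_n)\in[H_0^1(\Omega)]^n$, and this synchronized solution is uniquely determined. These solutions form the synchronized solution branch $$\mathcal T_\omega=\{(\beta,\alpha_1(\beta)\omega,\dots,\alpha_n(\beta)\omega):\beta\in I\},\qquad \alpha_j(\beta)=\big((\beta-\mu_j)g(\beta)\big)^{-1/2}.$$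
   Context: $\omega\in H_0^1(\Omega)$ denotes the unique positive (and non-degenerate) solution of $-\Delta\omega-\omega=-\omega^3$. A solution $(u_1,\dots,u_n)$ is called synchronized if $u_j=\alpha_j\omega$ with constants $\alpha_j>0$ for all $j$. Let $g(\beta)=1+\beta\sum_{j=1}^n\frac{1}{\mu_j-\beta}$ for $\beta\notin\{\mu_1,\dots,\mu_n\}$. The system is called focusing if $0<\mu_1\le\dots\le\mu_n$, defocusing if $\mu_1\le\dots\le\mu_n<0$, and mixed otherwise. In the focusing case $\bar\beta$ denotes the unique zero of $g$ in $(-\infty,0)$; in the defocusing case $\bar\beta$ denotes the unique zero of $g$ in $(\mu_n,\infty)$. *)

theory Defs
  imports "HOL-Analysis.Analysis"
begin

definition is_test :: "'a::euclidean_space set \<Rightarrow> ('a \<Rightarrow> real) \<Rightarrow> ('a \<Rightarrow> 'a) \<Rightarrow> bool" where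
  "is_test \<Omega> \<phi> g \<longleftrightarrow>
     (\<forall>x. (\<phi> has_derivative (\<lambda>h. g x \<bullet> h)) (at x)) \<and> continuous_on UNIV g \<and>
     compact (closure {x. \<phi> x \<noteq> 0}) \<and> closure {x. \<phi> x \<noteq> 0} \<subseteq> \<Omega>"

definition L2_on :: "'a::euclidean_space set \<Rightarrow> ('a \<Rightarrow> real) \<Rightarrow> bool" where
  "L2_on \<Omega> u \<longleftrightarrow> set_borel_measurable lebesgue \<Omega> u \<and> set_integrable lebesgue \<Omega> (\<lambda>x. (u x)^2)"

definition weak_grad :: "'a::euclidean_space set \<Rightarrow> ('a \<Rightarrow> real) \<Rightarrow> ('a \<Rightarrow> 'a) \<Rightarrow> bool" where
  "weak_grad \<Omega> u G \<longleftrightarrow> L2_on \<Omega> u \<and> (\<forall>i\<in>Basis. L2_on \<Omega> (\<lambda>x. G x \<bullet> i)) \<and>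
     (\<forall>\<phi> g. is_test \<Omega> \<phi> g \<longrightarrow>
        set_lebesgue_integral lebesgue \<Omega> (\<lambda>x. u x *\<^sub>R g x)
          = - set_lebesgue_integral lebesgue \<Omega> (\<lambda>x. \<phi> x *\<^sub>R G x))"

definition H01_grad :: "'a::euclidean_space set \<Rightarrow> ('a \<Rightarrow> real) \<Rightarrow> ('a \<Rightarrow> 'a) \<Rightarrow> bool" where
  "H01_grad \<Omega> u G \<longleftrightarrow> weak_grad \<Omega> u G \<and>
     (\<exists>\<phi>s gs. (\<forall>k. is_test \<Omega> (\<phi>s k) (gs k)) \<and>
        (\<lambda>k. set_lebesgue_integral lebesgue \<Omega>
               (\<lambda>x. (\<phi>s k x - u x)^2 + (norm (gs k x - G x))^2)) \<longlonglongrightarrow> 0)"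

definition in_H01 :: "'a::euclidean_space set \<Rightarrow> ('a \<Rightarrow> real) \<Rightarrow> bool" where
  "in_H01 \<Omega> u \<longleftrightarrow> (\<exists>G. H01_grad \<Omega> u G)"

definition dirichlet_lambda1 :: "'a::euclidean_space set \<Rightarrow> real" where
  "dirichlet_lambda1 \<Omega> = Inf {set_lebesgue_integral lebesgue \<Omega> (\<lambda>x. (norm (G x))^2)
        / set_lebesgue_integral lebesgue \<Omega> (\<lambda>x. (v x)^2) | v G.
        H01_grad \<Omega> v G \<and> set_lebesgue_integral lebesgue \<Omega> (\<lambda>x. (v x)^2) > 0}"

definition weak_sol :: "'a::euclidean_space set \<Rightarrow> ('a \<Rightarrow> real) \<Rightarrow> ('a \<Rightarrow> real) \<Rightarrow> bool" where
  "weak_sol \<Omega> F u \<longleftrightarrow> (\<exists>G. H01_grad \<Omega> u G \<and>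
     (\<forall>\<phi> g. is_test \<Omega> \<phi> g \<longrightarrow>
        set_lebesgue_integral lebesgue \<Omega> (\<lambda>x. G x \<bullet> g x - u x * \<phi> x)
          = set_lebesgue_integral lebesgue \<Omega> (\<lambda>x. F x * \<phi> x)))"

definition sys_solution :: "'a::euclidean_space set \<Rightarrow> nat \<Rightarrow> (nat \<Rightarrow> real) \<Rightarrow> real
     \<Rightarrow> (nat \<Rightarrow> 'a \<Rightarrow> real) \<Rightarrow> bool" where
  "sys_solution \<Omega> n \<mu> \<beta> u \<longleftrightarrow> (\<forall>j\<in>{1..n}.
      (\<forall>x\<in>\<Omega>. u j x > 0) \<and>
      weak_sol \<Omega> (\<lambda>x. \<mu> j * (u j x)^3 + \<beta> * (\<Sum>k\<in>{1..n}-{j}. (u k x)^2) * u j x) (u j))"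

definition synchronized_sol :: "'a::euclidean_space set \<Rightarrow> nat \<Rightarrow> (nat \<Rightarrow> real) \<Rightarrow> real
     \<Rightarrow> ('a \<Rightarrow> real) \<Rightarrow> (nat \<Rightarrow> real) \<Rightarrow> bool" where
  "synchronized_sol \<Omega> n \<mu> \<beta> \<omega> \<alpha> \<longleftrightarrow> (\<forall>j\<in>{1..n}. \<alpha> j > 0) \<and>
      sys_solution \<Omega> n \<mu> \<beta> (\<lambda>j x. \<alpha> j * \<omega> x)"

definition gfun :: "nat \<Rightarrow> (nat \<Rightarrow> real) \<Rightarrow> real \<Rightarrow> real" where
  "gfun n \<mu> \<beta> = 1 + \<beta> * (\<Sum>j=1..n. 1 / (\<mu> j - \<beta>))"

definition focusing :: "nat \<Rightarrow> (nat \<Rightarrow> real) \<Rightarrow> bool" where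
  "focusing n \<mu> \<longleftrightarrow> 0 < \<mu> 1"

definition defocusing :: "nat \<Rightarrow> (nat \<Rightarrow> real) \<Rightarrow> bool" where
  "defocusing n \<mu> \<longleftrightarrow> \<mu> n < 0"

definition beta_bar :: "nat \<Rightarrow> (nat \<Rightarrow> real) \<Rightarrow> real" where
  "beta_bar n \<mu> = (if focusing n \<mu> then (THE b. b < 0 \<and> gfun n \<mu> b = 0)
                    else (THE b. \<mu> n < b \<and> gfun n \<mu> b = 0))"

definition I_set :: "nat \<Rightarrow> (nat \<Rightarrow> real) \<Rightarrow> real set" where
  "I_set n \<mu> = (if focusing n \<mu> then {..< beta_bar n \<mu>}
                 else if defocusing n \<mu> then {..< \<mu> 1} \<union> {\<mu> n <..< beta_bar n \<mu>}
                 else {..< \<mu> 1})"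

definition alpha_branch :: "nat \<Rightarrow> (nat \<Rightarrow> real) \<Rightarrow> real \<Rightarrow> nat \<Rightarrow> real" where
  "alpha_branch n \<mu> \<beta> j = ((\<beta> - \<mu> j) * gfun n \<mu> \<beta>) powr (-1/2)"

end

theory Submission
  imports Defs
begin

text \<open>
  For \<open>u\<^sub>j = \<alpha>\<^sub>j \<omega>\<close> every right-hand side of the system is a multiple of \<open>\<omega>\<^sup>3\<close>, so scaling the
  equation of \<open>\<omega>\<close> shows that a solution arises as soon as the squares \<open>\<alpha>\<^sub>j\<^sup>2\<close> satisfy the linear system
  \<open>\<mu>\<^sub>j \<alpha>\<^sub>j\<^sup>2 + \<beta> (\<Sum>k\<noteq>j. \<alpha>\<^sub>k\<^sup>2) = -1\<close>. Writing it with \<open>s = (\<Sum>k. \<alpha>\<^sub>k\<^sup>2)\<close> gives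
  \<open>\<alpha>\<^sub>j\<^sup>2 = (1 + \<beta> s) / (\<beta> - \<mu>\<^sub>j)\<close> and, after summation, \<open>1 + \<beta> s = 1 / g(\<beta>)\<close>. The sign of \<open>g\<close> is read
  off from \<open>g(\<beta>) = 1 - n + (\<Sum>j. \<mu>\<^sub>j / (\<mu>\<^sub>j - \<beta>))\<close>.

  Conversely, the linear system is necessary because one test function \<open>\<phi>\<close> with
  \<open>\<integral>\<omega>\<^sup>3 \<phi> > 0\<close> forces the coefficients of \<open>\<omega>\<^sup>3\<close> to agree. A Bochner integral that does not exist is
  \<open>0\<close>, so this needs \<open>\<omega> \<in> L\<^sup>3\<close>, which is where the dimension enters: for a test function,
  \<open>\<phi>\<^sup>2\<close> is bounded by the integral of \<open>\<phi>\<^sup>2 + |\<nabla>\<phi>|\<^sup>2\<close> along every coordinate line, and the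
  Loomis--Whitney inequality turns this into a bound of \<open>\<integral>|\<phi>|\<^sup>3\<close> by the \<open>H\<^sup>1\<close> norm. Fatou's lemma
  carries the bound over to \<open>H\<^sub>0\<^sup>1\<close>.
\<close>

section \<open>The Loomis--Whitney inequality\<close>

text \<open>The weight \<open>t\<close> stays free so that it can be optimised after integration.
  For finite values the claim comes from \<open>(t * a - b / t)^2 \<ge> 0\<close>; an infinite
  \<open>f\<close> or \<open>g\<close> makes the right-hand side infinite, since both weights are
  positive.\<close>

lemma ennreal_amgm:
  fixes h f g :: ennreal and t :: real
  assumes "h^2 \<le> f * g" "t > 0"
  shows "2 * h \<le> ennreal t * f + ennreal (1/t) * g"
proof (cases "f = top \<or> g = top")
  case True
  then show ?thesis using assms(2) by (auto simp: ennreal_mult_top ennreal_top_mult)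
next
  case False
  then obtain a b where a: "a \<ge> 0" "f = ennreal a" and b: "b \<ge> 0" "g = ennreal b"
    by (metis ennreal_cases)
  have "h \<noteq> top"
    using assms(1) a b by (auto simp: ennreal_mult[symmetric] top_unique)
  then obtain c where c: "c \<ge> 0" "h = ennreal c" by (metis ennreal_cases)
  have cab: "c^2 \<le> a * b"
    using assms(1) a b c by (simp add: ennreal_mult[symmetric] ennreal_power)
  have "(2*c)^2 \<le> (t*a + (1/t)*b)^2"
  proof -
    have "(t*a + (1/t)*b)^2 - 4*(a*b) = (t*a - (1/t)*b)^2"
      using assms(2) by (simp add: power2_eq_square field_simps)
    moreover have "\<dots> \<ge> 0" by simp
    ultimately have "4*(a*b) \<le> (t*a + (1/t)*b)^2" by linarith
    then show ?thesis using cab by (simp add: power_mult_distrib)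
  qed
  then have "2*c \<le> t*a + (1/t)*b"
    by (rule power2_le_imp_le) (use a b assms in auto)
  then show ?thesis
    using a b c assms(2)
    by (simp add: ennreal_mult[symmetric] flip: ennreal_numeral ennreal_plus)
qed

text \<open>Stating Cauchy--Schwarz with \<open>h\<^sup>2 \<le> f g\<close> avoids square roots of \<^typ>\<open>ennreal\<close> values.\<close>

lemma nn_integral_square_le_mult:
  fixes h f g :: "'a \<Rightarrow> ennreal"
  assumes [measurable]: "h \<in> borel_measurable M" "f \<in> borel_measurable M" "g \<in> borel_measurable M"
    and le: "\<And>x. (h x)^2 \<le> f x * g x"
  shows "(\<integral>\<^sup>+x. h x \<partial>M)^2 \<le> (\<integral>\<^sup>+x. f x \<partial>M) * (\<integral>\<^sup>+x. g x \<partial>M)"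
proof (cases "(\<integral>\<^sup>+x. f x \<partial>M) = 0 \<or> (\<integral>\<^sup>+x. g x \<partial>M) = 0")
  \<comment> \<open>With one integral zero and the other possibly infinite, no weight balances the
    two sides, so \<open>h = 0\<close> almost everywhere is derived directly.\<close>
  case True
  then have "(AE x in M. f x = 0) \<or> (AE x in M. g x = 0)"
    by (simp add: nn_integral_0_iff_AE)
  then have "AE x in M. h x = 0"
  proof (elim disjE)
    assume "AE x in M. f x = 0" then show ?thesis
    proof eventually_elim
      fix x assume "f x = 0" then show "h x = 0" using le[of x] by simp
    qed
  next
    assume "AE x in M. g x = 0" then show ?thesis
    proof eventually_elim
      fix x assume "g x = 0" then show "h x = 0" using le[of x] by simp
    qed
  qed
  then have "(\<integral>\<^sup>+x. h x \<partial>M) = 0" by (simp add: nn_integral_0_iff_AE)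
  then show ?thesis by simp
next
  case nz: False
  show ?thesis
  proof (cases "(\<integral>\<^sup>+x. f x \<partial>M) = top \<or> (\<integral>\<^sup>+x. g x \<partial>M) = top")
    case True
    then show ?thesis using nz by (auto simp: ennreal_mult_eq_top_iff ennreal_top_mult ennreal_mult_top)
  next
    case False
    then obtain A B where A: "A \<ge> 0" "(\<integral>\<^sup>+x. f x \<partial>M) = ennreal A"
      and B: "B \<ge> 0" "(\<integral>\<^sup>+x. g x \<partial>M) = ennreal B" by (metis ennreal_cases)
    have AB: "A > 0" "B > 0" using nz A B by (auto simp: order_less_le)
    \<comment> \<open>This weight minimises \<open>t * A + B / t\<close>: both summands become
      \<open>sqrt (A * B)\<close>.\<close>
    define t where "t = sqrt (B / A)"
    have t: "t > 0" using AB by (simp add: t_def)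
    have "2 * (\<integral>\<^sup>+x. h x \<partial>M) = (\<integral>\<^sup>+x. 2 * h x \<partial>M)" by (simp add: nn_integral_cmult)
    also have "\<dots> \<le> (\<integral>\<^sup>+x. ennreal t * f x + ennreal (1/t) * g x \<partial>M)"
      by (intro nn_integral_mono ennreal_amgm le t)
    also have "\<dots> = ennreal t * ennreal A + ennreal (1/t) * ennreal B"
      by (simp add: nn_integral_add nn_integral_cmult A B)
    also have "\<dots> = ennreal (t * A + (1/t) * B)"
      using t A B by (simp add: ennreal_mult[symmetric] flip: ennreal_plus)
    also have "t * A + (1/t) * B = 2 * sqrt (A * B)"
      using AB by (simp add: t_def real_sqrt_divide real_sqrt_mult field_simps)
    finally have "2 * (\<integral>\<^sup>+x. h x \<partial>M) \<le> 2 * ennreal (sqrt (A * B))"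
      using AB by (simp add: ennreal_mult)
    then have "(\<integral>\<^sup>+x. h x \<partial>M) \<le> ennreal (sqrt (A * B))"
      by (simp add: ennreal_mult_le_mult_iff)
    then have "(\<integral>\<^sup>+x. h x \<partial>M)^2 \<le> (ennreal (sqrt (A * B)))^2" by (rule power_mono) simp
    also have "\<dots> = ennreal A * ennreal B"
      using AB by (simp add: ennreal_power ennreal_mult[symmetric])
    finally show ?thesis by (simp add: A B)
  qed
qed

section \<open>Integrals as iterated coordinate integrals in dimensions one to three\<close>

lemma nn_integral_lborel_Basis:
  fixes F :: "'a::euclidean_space \<Rightarrow> ennreal"
  assumes [measurable]: "F \<in> borel_measurable borel"
  shows "(\<integral>\<^sup>+x. F x \<partial>lborel) = (\<integral>\<^sup>+y. F (\<Sum>b\<in>Basis. y b *\<^sub>R b) \<partial>PiM Basis (\<lambda>_. lborel))"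
  by (subst lborel_eq, subst nn_integral_distr) auto

interpretation lborel_product: product_sigma_finite "\<lambda>_::'i. lborel :: real measure"
  by standard

lemma nn_integral_lborel_1:
  fixes F :: "'a::euclidean_space \<Rightarrow> ennreal"
  assumes [measurable]: "F \<in> borel_measurable borel" and B: "(Basis::'a set) = {i}"
  shows "(\<integral>\<^sup>+x. F x \<partial>lborel) = (\<integral>\<^sup>+a. F (a *\<^sub>R i) \<partial>lborel)"
  by (subst nn_integral_lborel_Basis, measurable)
     (simp add: B lborel_product.product_nn_integral_singleton[where f = "\<lambda>a. F (a *\<^sub>R i)"])

lemma nn_integral_lborel_2:
  fixes F :: "'a::euclidean_space \<Rightarrow> ennreal"
  assumes [measurable]: "F \<in> borel_measurable borel" and B: "(Basis::'a set) = {i, j}" "i \<noteq> j"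
  shows "(\<integral>\<^sup>+x. F x \<partial>lborel) = (\<integral>\<^sup>+a. \<integral>\<^sup>+b. F (a *\<^sub>R i + b *\<^sub>R j) \<partial>lborel \<partial>lborel)"
proof -
  have [simp]: "j \<noteq> i" using B by simp
  have "(\<integral>\<^sup>+x. F x \<partial>lborel) = (\<integral>\<^sup>+y. F (y i *\<^sub>R i + y j *\<^sub>R j) \<partial>PiM {i,j} (\<lambda>_. lborel))"
    by (subst nn_integral_lborel_Basis, measurable) (simp add: B)
  also have "\<dots> = (\<integral>\<^sup>+a. \<integral>\<^sup>+y. F (a *\<^sub>R i + y j *\<^sub>R j) \<partial>PiM {j} (\<lambda>_. lborel) \<partial>lborel)"
    by (subst lborel_product.product_nn_integral_insert_rev) (simp_all add: B(2-))
  also have "\<dots> = (\<integral>\<^sup>+a. \<integral>\<^sup>+b. F (a *\<^sub>R i + b *\<^sub>R j) \<partial>lborel \<partial>lborel)"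
    by (intro nn_integral_cong lborel_product.product_nn_integral_singleton) measurable
  finally show ?thesis .
qed

text \<open>\<open>i\<close>, \<open>j\<close>, \<open>k\<close> may be any enumeration of the
  basis, so instances of this one lemma give every order of integration, and the coordinate
  integrals need not be exchanged separately later.\<close>

lemma nn_integral_lborel_3:
  fixes F :: "'a::euclidean_space \<Rightarrow> ennreal"
  assumes [measurable]: "F \<in> borel_measurable borel"
    and B: "(Basis::'a set) = {i, j, k}" "i \<noteq> j" "i \<noteq> k" "j \<noteq> k"
  shows "(\<integral>\<^sup>+x. F x \<partial>lborel)
    = (\<integral>\<^sup>+a. \<integral>\<^sup>+b. \<integral>\<^sup>+c. F (a *\<^sub>R i + b *\<^sub>R j + c *\<^sub>R k) \<partial>lborel \<partial>lborel \<partial>lborel)"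
proof -
  have [simp]: "j \<noteq> i" "k \<noteq> i" "k \<noteq> j" using B by auto
  have "(\<integral>\<^sup>+x. F x \<partial>lborel)
      = (\<integral>\<^sup>+y. F (y i *\<^sub>R i + y j *\<^sub>R j + y k *\<^sub>R k) \<partial>PiM {i,j,k} (\<lambda>_. lborel))"
    by (subst nn_integral_lborel_Basis, measurable) (simp add: B add.assoc)
  also have "\<dots> = (\<integral>\<^sup>+a. \<integral>\<^sup>+y. F (a *\<^sub>R i + y j *\<^sub>R j + y k *\<^sub>R k)
      \<partial>PiM {j,k} (\<lambda>_. lborel) \<partial>lborel)"
    by (subst lborel_product.product_nn_integral_insert_rev) (simp_all add: B(2-))
  also have "\<dots> = (\<integral>\<^sup>+a. \<integral>\<^sup>+b. \<integral>\<^sup>+y. F (a *\<^sub>R i + b *\<^sub>R j + y k *\<^sub>R k)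
      \<partial>PiM {k} (\<lambda>_. lborel) \<partial>lborel \<partial>lborel)"
    by (intro nn_integral_cong, subst lborel_product.product_nn_integral_insert_rev) (simp_all add: B(2-))
  also have "\<dots> = (\<integral>\<^sup>+a. \<integral>\<^sup>+b. \<integral>\<^sup>+c. F (a *\<^sub>R i + b *\<^sub>R j + c *\<^sub>R k)
      \<partial>lborel \<partial>lborel \<partial>lborel)"
    by (intro nn_integral_cong lborel_product.product_nn_integral_singleton) measurable
  finally show ?thesis .
qed

text \<open>Cauchy--Schwarz is applied once per variable, first in \<open>c\<close>, then in
  \<open>b\<close>, then in \<open>a\<close>. Each of \<open>u\<close>, \<open>v\<close>,
  \<open>w\<close> misses one variable, so at every stage one factor is constant and leaves the
  integral.\<close>

lemma Loomis_Whitney_3: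
  fixes h :: "real \<Rightarrow> real \<Rightarrow> real \<Rightarrow> ennreal" and u v w :: "real \<Rightarrow> real \<Rightarrow> ennreal"
  assumes [measurable]: "(\<lambda>(a,b,c). h a b c) \<in> borel_measurable (borel \<Otimes>\<^sub>M borel \<Otimes>\<^sub>M borel)"
    "case_prod u \<in> borel_measurable (borel \<Otimes>\<^sub>M borel)"
    "case_prod v \<in> borel_measurable (borel \<Otimes>\<^sub>M borel)"
    "case_prod w \<in> borel_measurable (borel \<Otimes>\<^sub>M borel)"
    and le: "\<And>a b c. (h a b c)^2 \<le> u b c * v a c * w a b"
  shows "(\<integral>\<^sup>+a. \<integral>\<^sup>+b. \<integral>\<^sup>+c. h a b c \<partial>lborel \<partial>lborel \<partial>lborel)^2
    \<le> (\<integral>\<^sup>+b. \<integral>\<^sup>+c. u b c \<partial>lborel \<partial>lborel) * (\<integral>\<^sup>+a. \<integral>\<^sup>+c. v a c \<partial>lborel \<partial>lborel)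
      * (\<integral>\<^sup>+a. \<integral>\<^sup>+b. w a b \<partial>lborel \<partial>lborel)"
proof -
  define U where "U b = (\<integral>\<^sup>+c. u b c \<partial>lborel)" for b
  define V where "V a = (\<integral>\<^sup>+c. v a c \<partial>lborel)" for a
  define W where "W a = (\<integral>\<^sup>+b. w a b \<partial>lborel)" for a
  have [measurable]: "U \<in> borel_measurable borel" "V \<in> borel_measurable borel"
    "W \<in> borel_measurable borel"
    unfolding U_def V_def W_def by measurable
  \<comment> \<open>Triples are re-bracketed so that the innermost integral is recognised as
    measurable in the remaining pair \<open>(a, b)\<close>.\<close>
  have "(\<lambda>p. case (fst (fst p), snd (fst p), snd p) of (a, b, c) \<Rightarrow> h a b c)
      \<in> borel_measurable ((borel \<Otimes>\<^sub>M borel) \<Otimes>\<^sub>M borel)"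
    by measurable
  then have [measurable]: "(\<lambda>(p, c). h (fst p) (snd p) c)
      \<in> borel_measurable ((borel \<Otimes>\<^sub>M borel) \<Otimes>\<^sub>M lborel)"
    by (simp add: case_prod_unfold)
  have [measurable]: "(\<lambda>p. \<integral>\<^sup>+c. h (fst p) (snd p) c \<partial>lborel)
      \<in> borel_measurable (borel \<Otimes>\<^sub>M lborel)"
    by measurable
  then have [measurable]: "(\<lambda>(a, b). \<integral>\<^sup>+c. h a b c \<partial>lborel)
      \<in> borel_measurable (borel \<Otimes>\<^sub>M lborel)"
    by (simp add: case_prod_unfold)
  have 1: "(\<integral>\<^sup>+c. h a b c \<partial>lborel)^2 \<le> (w a b * V a) * U b" for a b
  proof -
    have "(\<integral>\<^sup>+c. h a b c \<partial>lborel)^2 \<le> (\<integral>\<^sup>+c. w a b * v a c \<partial>lborel) * (\<integral>\<^sup>+c. u b c \<partial>lborel)"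
      by (rule nn_integral_square_le_mult) (use le in \<open>auto simp: mult_ac\<close>)
    then show ?thesis by (simp add: nn_integral_cmult U_def V_def)
  qed
  have 2: "(\<integral>\<^sup>+b. \<integral>\<^sup>+c. h a b c \<partial>lborel \<partial>lborel)^2 \<le> W a * (V a * (\<integral>\<^sup>+b. U b \<partial>lborel))" for a
  proof -
    have "(\<integral>\<^sup>+b. \<integral>\<^sup>+c. h a b c \<partial>lborel \<partial>lborel)^2 \<le> (\<integral>\<^sup>+b. w a b * V a \<partial>lborel) * (\<integral>\<^sup>+b. U b \<partial>lborel)"
      by (rule nn_integral_square_le_mult) (use 1 in auto)
    then show ?thesis by (simp add: nn_integral_multc W_def mult.assoc)
  qed
  have "(\<integral>\<^sup>+a. \<integral>\<^sup>+b. \<integral>\<^sup>+c. h a b c \<partial>lborel \<partial>lborel \<partial>lborel)^2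
     \<le> (\<integral>\<^sup>+a. W a \<partial>lborel) * (\<integral>\<^sup>+a. V a * (\<integral>\<^sup>+b. U b \<partial>lborel) \<partial>lborel)"
    by (rule nn_integral_square_le_mult) (use 2 in auto)
  then show ?thesis by (simp add: nn_integral_multc U_def V_def W_def mult_ac)
qed

section \<open>The embedding into L3\<close>

lemma is_testD:
  assumes "is_test \<Omega> \<phi> g"
  shows "continuous_on UNIV \<phi>" "continuous_on UNIV g"
    "\<And>x. (\<phi> has_derivative (\<lambda>h. g x \<bullet> h)) (at x)"
  using assms unfolding is_test_def
  by (auto intro!: has_derivative_continuous continuous_at_imp_continuous_on)

text \<open>Off the closed support the function is locally zero, so uniqueness of derivatives
  annihilates every \<open>g x \<bullet> h\<close>; the choice \<open>h = g x\<close> then settles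
  the gradient.\<close>

lemma is_test_zero_outside:
  fixes x :: "'a::euclidean_space"
  assumes "is_test \<Omega> \<phi> g" "x \<notin> closure {x. \<phi> x \<noteq> 0}"
  shows "\<phi> x = 0" "g x = 0"
proof -
  let ?K = "closure {x. \<phi> x \<noteq> 0}"
  have z: "y \<in> - ?K \<Longrightarrow> \<phi> y = 0" for y
    using closure_subset[of "{x. \<phi> x \<noteq> 0}"] by auto
  show "\<phi> x = 0" using assms(2) by (intro z) simp
  have "((\<lambda>y. 0) has_derivative (\<lambda>h. g x \<bullet> h)) (at x)"
    by (rule has_derivative_transform_within_open[OF is_testD(3)[OF assms(1)], where s = "- ?K"])
       (use assms(2) in \<open>auto intro: z\<close>)
  then have "(\<lambda>h. g x \<bullet> h) = (\<lambda>h. 0)"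
    by (rule has_derivative_unique[OF _ has_derivative_const])
  then have "g x \<bullet> g x = 0" by (rule fun_cong)
  then show "g x = 0" by simp
qed

text \<open>Fundamental theorem of calculus for \<open>\<phi>^2\<close>, started outside the
  support, together with \<open>2 * \<bar>\<phi>\<bar> * norm g \<le> \<phi>^2 + (norm g)^2\<close>.
  The right-hand side does not depend on \<open>s\<close>; this missing variable is what
  Loomis--Whitney exploits.\<close>

lemma is_test_square_le_line_integral:
  fixes i y :: "'a::euclidean_space"
  assumes t: "is_test \<Omega> \<phi> g" and i: "i \<in> Basis"
  shows "ennreal ((\<phi> (y + s *\<^sub>R i))^2)
    \<le> (\<integral>\<^sup>+r. ennreal ((\<phi> (y + r *\<^sub>R i))^2 + (norm (g (y + r *\<^sub>R i)))^2) \<partial>lborel)"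
proof -
  have "bounded (closure {x. \<phi> x \<noteq> 0})"
    using t by (auto simp: is_test_def compact_imp_bounded)
  then obtain R where R: "\<And>x. x \<in> closure {x. \<phi> x \<noteq> 0} \<Longrightarrow> norm x \<le> R"
    by (auto simp: bounded_iff)
  \<comment> \<open>Far enough out that \<open>y + a *\<^sub>R i\<close> leaves the ball of radius
    \<open>R\<close>, so \<open>\<phi>\<close> vanishes there. The absolute value covers a negative
    \<open>R\<close>, possible for an empty support.\<close>
  define a where "a = min s (- (\<bar>R\<bar> + norm y) - 1)"
  have "norm (y + a *\<^sub>R i) \<ge> norm (a *\<^sub>R i) - norm y"
    by (metis add.commute norm_diff_ineq)
  moreover have "norm (a *\<^sub>R i) = \<bar>a\<bar>" using i by simp
  moreover have "\<bar>a\<bar> > \<bar>R\<bar> + norm y"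
    unfolding a_def using norm_ge_zero[of y] by linarith
  ultimately have "norm (y + a *\<^sub>R i) > R" by linarith
  then have a0: "\<phi> (y + a *\<^sub>R i) = 0"
    using R[of "y + a *\<^sub>R i"] by (intro is_test_zero_outside(1)[OF t]) linarith
  define F where "F r = (\<phi> (y + r *\<^sub>R i))^2" for r
  define f where "f r = 2 * \<phi> (y + r *\<^sub>R i) * (g (y + r *\<^sub>R i) \<bullet> i)" for r
  have cont: "continuous_on UNIV (\<lambda>r. \<phi> (y + r *\<^sub>R i))" "continuous_on UNIV (\<lambda>r. g (y + r *\<^sub>R i))"
    by (rule continuous_on_compose2[OF is_testD(1)[OF t]] continuous_on_compose2[OF is_testD(2)[OF t]];
        auto intro!: continuous_intros)+
  have D: "(F has_real_derivative f r) (at r)" for r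
  proof -
    have "((\<lambda>r. y + r *\<^sub>R i) has_derivative (\<lambda>h. h *\<^sub>R i)) (at r)"
      by (auto intro!: derivative_eq_intros)
    from diff_chain_at[OF this is_testD(3)[OF t]]
    have "((\<lambda>r. \<phi> (y + r *\<^sub>R i)) has_real_derivative (g (y + r *\<^sub>R i) \<bullet> i)) (at r)"
      by (simp add: has_field_derivative_def o_def mult.commute[of _ "g _ \<bullet> i"])
    then show ?thesis unfolding F_def f_def
      by (auto intro!: derivative_eq_intros)
  qed
  have cf: "isCont f r" for r
    unfolding f_def using cont by (intro continuous_intros) (auto simp: continuous_on_eq_continuous_at)
  have "a \<le> s" by (simp add: a_def)
  have B: "has_bochner_integral lborel (\<lambda>r. f r * indicator {a..s} r) (F s - F a)"
    by (rule has_bochner_integral_FTC_Icc_real[OF \<open>a \<le> s\<close>]) (use D cf in auto)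
  have "ennreal ((\<phi> (y + s *\<^sub>R i))^2) = ennreal (norm (F s - F a))"
    by (simp add: F_def a0)
  also have "F s - F a = (\<integral>r. f r * indicator {a..s} r \<partial>lborel)"
    using B by (simp add: has_bochner_integral_iff)
  also have "ennreal (norm \<dots>) \<le> (\<integral>\<^sup>+r. norm (f r * indicator {a..s} r) \<partial>lborel)"
    using B by (intro integral_norm_bound_ennreal) (simp add: has_bochner_integral_iff)
  also have "\<dots> \<le> (\<integral>\<^sup>+r. ennreal ((\<phi> (y + r *\<^sub>R i))^2 + (norm (g (y + r *\<^sub>R i)))^2) \<partial>lborel)"
  proof (intro nn_integral_mono ennreal_leI)
    fix r
    have "\<bar>g (y + r *\<^sub>R i) \<bullet> i\<bar> \<le> norm (g (y + r *\<^sub>R i))"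
      using Basis_le_norm[OF i] .
    then have "\<bar>f r\<bar> \<le> 2 * \<bar>\<phi> (y + r *\<^sub>R i)\<bar> * norm (g (y + r *\<^sub>R i))"
      by (auto simp: f_def abs_mult intro!: mult_left_mono)
    also have "\<dots> \<le> \<bar>\<phi> (y + r *\<^sub>R i)\<bar>^2 + (norm (g (y + r *\<^sub>R i)))^2"
      by (rule sum_squares_bound)
    finally show "norm (f r * indicator {a..s} r) \<le> (\<phi> (y + r *\<^sub>R i))^2 + (norm (g (y + r *\<^sub>R i)))^2"
      by (auto simp: indicator_def)
  qed
  finally show ?thesis .
qed

text \<open>Interpolation through \<open>\<bar>t\<bar>^3 \<le> t^2 + t^4\<close>, meant for
  dimensions one and two, where the line bound controls the fourth power.\<close>

lemma nn_integral_cube_le_of_fourth_power: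
  fixes \<phi> :: "'a::euclidean_space \<Rightarrow> real"
  assumes [measurable]: "\<phi> \<in> borel_measurable borel"
    and "(\<integral>\<^sup>+x. ennreal ((\<phi> x)^2) \<partial>lborel) \<le> A" "(\<integral>\<^sup>+x. ennreal ((\<phi> x)^2)^2 \<partial>lborel) \<le> B"
  shows "(\<integral>\<^sup>+x. ennreal (\<bar>\<phi> x\<bar>^3) \<partial>lborel) \<le> A + B"
proof -
  have "\<bar>\<phi> x\<bar>^3 \<le> (\<phi> x)^2 + ((\<phi> x)^2)^2" for x
  proof -
    have "2 * \<bar>\<phi> x\<bar> \<le> 1 + \<bar>\<phi> x\<bar>^2" using sum_squares_bound[of 1 "\<bar>\<phi> x\<bar>"] by simp
    then have "\<bar>\<phi> x\<bar> \<le> 1 + \<bar>\<phi> x\<bar>^2" by linarith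
    then have "\<bar>\<phi> x\<bar>^2 * \<bar>\<phi> x\<bar> \<le> \<bar>\<phi> x\<bar>^2 * (1 + \<bar>\<phi> x\<bar>^2)" by (intro mult_left_mono) auto
    then show ?thesis by (simp add: power3_eq_cube power2_eq_square algebra_simps)
  qed
  then have "(\<integral>\<^sup>+x. ennreal (\<bar>\<phi> x\<bar>^3) \<partial>lborel)
     \<le> (\<integral>\<^sup>+x. ennreal ((\<phi> x)^2) + ennreal ((\<phi> x)^2)^2 \<partial>lborel)"
    by (intro nn_integral_mono) (simp add: ennreal_power ennreal_leI flip: ennreal_plus)
  also have "\<dots> = (\<integral>\<^sup>+x. ennreal ((\<phi> x)^2) \<partial>lborel) + (\<integral>\<^sup>+x. ennreal ((\<phi> x)^2)^2 \<partial>lborel)"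
    by (rule nn_integral_add) auto
  also have "\<dots> \<le> A + B" using assms(2,3) by (rule add_mono)
  finally show ?thesis .
qed

text \<open>\<open>M\<close> is the squared H1 norm over the whole space. The polynomial is a common
  bound for three different estimates; later only its monotonicity and its finiteness for finite
  \<open>M\<close> matter.\<close>

lemma is_test_L3_bound:
  fixes \<phi> :: "'a::euclidean_space \<Rightarrow> real"
  assumes dim: "DIM('a) \<le> 3" and t: "is_test \<Omega> \<phi> g"
  defines "M \<equiv> (\<integral>\<^sup>+x. ennreal ((\<phi> x)^2 + (norm (g x))^2) \<partial>lborel)"
  shows "(\<integral>\<^sup>+x. ennreal (\<bar>\<phi> x\<bar>^3) \<partial>lborel) \<le> 1 + M + M^2 + M^3"
proof -
  have \<phi>[measurable]: "\<phi> \<in> borel_measurable borel" and [measurable]: "g \<in> borel_measurable borel"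
    using is_testD[OF t] by (auto intro: borel_measurable_continuous_onI)
  define H where "H x = ennreal ((\<phi> x)^2 + (norm (g x))^2)" for x
  have [measurable]: "H \<in> borel_measurable borel" unfolding H_def by measurable
  have M: "M = (\<integral>\<^sup>+x. H x \<partial>lborel)" by (simp add: M_def H_def)
  have line: "ennreal ((\<phi> (y + s *\<^sub>R i))^2) \<le> (\<integral>\<^sup>+r. H (y + r *\<^sub>R i) \<partial>lborel)"
    if "i \<in> Basis" for y s i
    using is_test_square_le_line_integral[OF t that, of y s] by (simp add: H_def)
  have L2: "(\<integral>\<^sup>+x. ennreal ((\<phi> x)^2) \<partial>lborel) \<le> M"
    unfolding M H_def by (intro nn_integral_mono ennreal_leI) auto
  have "card (Basis::'a set) = 1 \<or> card (Basis::'a set) = 2 \<or> card (Basis::'a set) = 3"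
    using dim DIM_positive[where 'a='a] by linarith
  then consider (1) "card (Basis::'a set) = 1" | (2) "card (Basis::'a set) = 2"
    | (3) "card (Basis::'a set) = 3" by blast
  then show ?thesis
  proof cases
    \<comment> \<open>The only coordinate line is the whole space, so
      \<open>\<phi>^2 \<le> M\<close> pointwise.\<close>
    case 1
    then obtain i where B: "(Basis::'a set) = {i}" by (auto simp: card_1_singleton_iff)
    have sup: "ennreal ((\<phi> x)^2) \<le> M" for x
    proof -
      have "(x \<bullet> i) *\<^sub>R i = x" using euclidean_representation[of x] unfolding B by simp
      then show ?thesis
        using line[of i 0 "x \<bullet> i"] by (simp add: M nn_integral_lborel_1[OF _ B] B)
    qed
    have "(\<integral>\<^sup>+x. ennreal ((\<phi> x)^2)^2 \<partial>lborel) \<le> (\<integral>\<^sup>+x. M * ennreal ((\<phi> x)^2) \<partial>lborel)"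
      unfolding power2_eq_square[of "ennreal _"]
      by (intro nn_integral_mono mult_right_mono sup) auto
    also have "\<dots> \<le> M * M" by (simp add: nn_integral_cmult mult_left_mono L2)
    finally have "(\<integral>\<^sup>+x. ennreal (\<bar>\<phi> x\<bar>^3) \<partial>lborel) \<le> M + M^2"
      by (intro nn_integral_cube_le_of_fourth_power \<phi> L2) (simp add: power2_eq_square)
    also have "\<dots> \<le> (M + M^2) + (1 + M^3)" by simp
    finally show ?thesis by (simp add: add_ac)
  next
    \<comment> \<open>The fourth power of \<open>\<phi>\<close> is at most a function of
      \<open>a\<close> times a function of \<open>b\<close>, and each of these integrates to
      \<open>M\<close>.\<close>
    case 2
    then obtain i j where B: "(Basis::'a set) = {i, j}" "i \<noteq> j" by (auto simp: card_2_iff)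
    have B': "(Basis::'a set) = {j, i}" "j \<noteq> i" using B by auto
    define u where "u b = (\<integral>\<^sup>+a. H (b *\<^sub>R j + a *\<^sub>R i) \<partial>lborel)" for b
    define v where "v a = (\<integral>\<^sup>+b. H (a *\<^sub>R i + b *\<^sub>R j) \<partial>lborel)" for a
    have [measurable]: "u \<in> borel_measurable borel" "v \<in> borel_measurable borel"
      unfolding u_def v_def by measurable
    have le: "ennreal ((\<phi> (a *\<^sub>R i + b *\<^sub>R j))^2) \<le> u b"
      "ennreal ((\<phi> (a *\<^sub>R i + b *\<^sub>R j))^2) \<le> v a" for a b
    proof -
      show "ennreal ((\<phi> (a *\<^sub>R i + b *\<^sub>R j))^2) \<le> u b"
        unfolding u_def add.commute[of "a *\<^sub>R i" "b *\<^sub>R j"] by (rule line) (simp add: B(1))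
      show "ennreal ((\<phi> (a *\<^sub>R i + b *\<^sub>R j))^2) \<le> v a"
        unfolding v_def by (rule line) (simp add: B(1))
    qed
    have uv: "(\<integral>\<^sup>+b. u b \<partial>lborel) = M" "(\<integral>\<^sup>+a. v a \<partial>lborel) = M"
      unfolding M u_def v_def
      by (subst nn_integral_lborel_2[OF _ B'], simp_all) (subst nn_integral_lborel_2[OF _ B], simp_all)
    have "(\<integral>\<^sup>+x. ennreal ((\<phi> x)^2)^2 \<partial>lborel)
      = (\<integral>\<^sup>+a. \<integral>\<^sup>+b. ennreal ((\<phi> (a *\<^sub>R i + b *\<^sub>R j))^2)^2 \<partial>lborel \<partial>lborel)"
      by (subst nn_integral_lborel_2[OF _ B]) auto
    also have "\<dots> \<le> (\<integral>\<^sup>+a. \<integral>\<^sup>+b. v a * u b \<partial>lborel \<partial>lborel)"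
      unfolding power2_eq_square[of "ennreal _"] by (intro nn_integral_mono mult_mono le) auto
    also have "\<dots> = M * M" by (simp add: nn_integral_cmult nn_integral_multc uv)
    finally have "(\<integral>\<^sup>+x. ennreal (\<bar>\<phi> x\<bar>^3) \<partial>lborel) \<le> M + M^2"
      by (intro nn_integral_cube_le_of_fourth_power \<phi> L2) (simp add: power2_eq_square)
    also have "\<dots> \<le> (M + M^2) + (1 + M^3)" by simp
    finally show ?thesis by (simp add: add_ac)
  next
    \<comment> \<open>Integrating along one coordinate leaves a function of the other two. The
      square of \<open>\<bar>\<phi>\<bar>^3\<close> is a product of three copies of
      \<open>\<phi>^2\<close>, and each copy is bounded by a different one of these
      functions.\<close>
    case 3
    then obtain i j k where B: "(Basis::'a set) = {i, j, k}" "i \<noteq> j" "i \<noteq> k" "j \<noteq> k"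
      by (auto simp: card_3_iff)
    define u where "u b c = (\<integral>\<^sup>+a. H (b *\<^sub>R j + c *\<^sub>R k + a *\<^sub>R i) \<partial>lborel)" for b c
    define v where "v a c = (\<integral>\<^sup>+b. H (a *\<^sub>R i + c *\<^sub>R k + b *\<^sub>R j) \<partial>lborel)" for a c
    define w where "w a b = (\<integral>\<^sup>+c. H (a *\<^sub>R i + b *\<^sub>R j + c *\<^sub>R k) \<partial>lborel)" for a b
    define h where "h a b c = ennreal (\<bar>\<phi> (a *\<^sub>R i + b *\<^sub>R j + c *\<^sub>R k)\<bar>^3)" for a b c
    have le: "ennreal ((\<phi> (a *\<^sub>R i + b *\<^sub>R j + c *\<^sub>R k))^2) \<le> u b c"
      "ennreal ((\<phi> (a *\<^sub>R i + b *\<^sub>R j + c *\<^sub>R k))^2) \<le> v a c"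
      "ennreal ((\<phi> (a *\<^sub>R i + b *\<^sub>R j + c *\<^sub>R k))^2) \<le> w a b" for a b c
    proof -
      have e: "a *\<^sub>R i + b *\<^sub>R j + c *\<^sub>R k = b *\<^sub>R j + c *\<^sub>R k + a *\<^sub>R i"
        "a *\<^sub>R i + b *\<^sub>R j + c *\<^sub>R k = a *\<^sub>R i + c *\<^sub>R k + b *\<^sub>R j"
        by (simp_all add: add_ac)
      show "ennreal ((\<phi> (a *\<^sub>R i + b *\<^sub>R j + c *\<^sub>R k))^2) \<le> u b c"
        unfolding u_def e(1) by (rule line) (simp add: B(1))
      show "ennreal ((\<phi> (a *\<^sub>R i + b *\<^sub>R j + c *\<^sub>R k))^2) \<le> v a c"
        unfolding v_def e(2) by (rule line) (simp add: B(1))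
      show "ennreal ((\<phi> (a *\<^sub>R i + b *\<^sub>R j + c *\<^sub>R k))^2) \<le> w a b"
        unfolding w_def by (rule line) (simp add: B(1))
    qed
    have "(\<integral>\<^sup>+b. \<integral>\<^sup>+c. u b c \<partial>lborel \<partial>lborel) = M"
      unfolding M u_def by (subst nn_integral_lborel_3[of H j k i]) (use B in auto)
    moreover have "(\<integral>\<^sup>+a. \<integral>\<^sup>+c. v a c \<partial>lborel \<partial>lborel) = M"
      unfolding M v_def by (subst nn_integral_lborel_3[of H i k j]) (use B in auto)
    moreover have "(\<integral>\<^sup>+a. \<integral>\<^sup>+b. w a b \<partial>lborel \<partial>lborel) = M"
      unfolding M w_def by (subst nn_integral_lborel_3[of H i j k]) (use B in auto)
    moreover have "(\<integral>\<^sup>+x. ennreal (\<bar>\<phi> x\<bar>^3) \<partial>lborel)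
      = (\<integral>\<^sup>+a. \<integral>\<^sup>+b. \<integral>\<^sup>+c. h a b c \<partial>lborel \<partial>lborel \<partial>lborel)"
      unfolding h_def by (subst nn_integral_lborel_3[OF _ B]) auto
    moreover have "(h a b c)^2 \<le> u b c * v a c * w a b" for a b c
    proof -
      have "(h a b c)^2 = ennreal ((\<phi> (a *\<^sub>R i + b *\<^sub>R j + c *\<^sub>R k))^2)
          * ennreal ((\<phi> (a *\<^sub>R i + b *\<^sub>R j + c *\<^sub>R k))^2) * ennreal ((\<phi> (a *\<^sub>R i + b *\<^sub>R j + c *\<^sub>R k))^2)"
        unfolding h_def by (simp add: ennreal_power ennreal_mult[symmetric])
      also have "\<dots> \<le> u b c * v a c * w a b" by (intro mult_mono le) auto
      finally show ?thesis .
    qed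
    ultimately have "(\<integral>\<^sup>+x. ennreal (\<bar>\<phi> x\<bar>^3) \<partial>lborel)^2 \<le> M * M * M"
      using Loomis_Whitney_3[of h u v w] unfolding h_def u_def v_def w_def by simp
    then have sq: "(\<integral>\<^sup>+x. ennreal (\<bar>\<phi> x\<bar>^3) \<partial>lborel)^2 \<le> M^3" by (simp add: power3_eq_cube)
    have "(\<integral>\<^sup>+x. ennreal (\<bar>\<phi> x\<bar>^3) \<partial>lborel) \<le> 1 + M^3"
    proof (cases "(\<integral>\<^sup>+x. ennreal (\<bar>\<phi> x\<bar>^3) \<partial>lborel) \<le> 1")
      case True then show ?thesis by (rule order_trans) simp
    next
      \<comment> \<open>A number above one is at most its own square, so no root of
        \<open>M^3\<close> has to be taken.\<close>
      case False
      then have "(\<integral>\<^sup>+x. ennreal (\<bar>\<phi> x\<bar>^3) \<partial>lborel) * 1 \<le> (\<integral>\<^sup>+x. ennreal (\<bar>\<phi> x\<bar>^3) \<partial>lborel)^2"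
        unfolding power2_eq_square by (intro mult_left_mono) auto
      also note sq
      also have "M^3 \<le> 1 + M^3" by simp
      finally show ?thesis by simp
    qed
    also have "\<dots> \<le> (1 + M^3) + (M + M^2)" by simp
    finally show ?thesis by (simp add: add_ac)
  qed
qed

section \<open>Square integrability on \<Omega> and passage from test functions to their H1
  limits\<close>

lemma integrable_lebesgue_compact_support:
  fixes f :: "'a::euclidean_space \<Rightarrow> real"
  assumes "continuous_on UNIV f" "compact K" "\<And>x. x \<notin> K \<Longrightarrow> f x = 0"
  shows "integrable lebesgue f"
proof -
  have "integrable lborel (\<lambda>x. indicator K x *\<^sub>R f x)"
    by (rule borel_integrable_compact[OF assms(2)]) (use assms(1) continuous_on_subset in blast)
  moreover have "(\<lambda>x. indicator K x *\<^sub>R f x) = f"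
    by (rule ext) (use assms(3) in \<open>auto simp: indicator_def\<close>)
  ultimately show ?thesis
    using assms(1) by (simp add: integrable_completion borel_measurable_continuous_onI)
qed

lemma is_test_L2_on:
  assumes "open \<Omega>" and t: "is_test \<Omega> \<phi> g"
  shows "L2_on \<Omega> \<phi>" "L2_on \<Omega> (\<lambda>x. g x \<bullet> i)"
proof -
  have *: "L2_on \<Omega> f" if c: "continuous_on UNIV f"
    and z: "\<And>x. x \<notin> closure {x. \<phi> x \<noteq> 0} \<Longrightarrow> f x = 0" for f
  proof -
    have "f \<in> borel_measurable lebesgue"
      using c by (intro measurable_completion) (simp add: borel_measurable_continuous_onI)
    moreover have "integrable lebesgue (\<lambda>x. (f x)^2)"
      by (rule integrable_lebesgue_compact_support[of _ "closure {x. \<phi> x \<noteq> 0}"])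
         (use t z c in \<open>auto simp: is_test_def intro!: continuous_intros\<close>)
    moreover have "\<Omega> \<in> sets lebesgue" using \<open>open \<Omega>\<close> by simp
    ultimately show ?thesis
      unfolding L2_on_def set_borel_measurable_def set_integrable_def
      by (intro conjI integrable_mult_indicator borel_measurable_scaleR borel_measurable_indicator)
  qed
  show "L2_on \<Omega> \<phi>" by (rule *[OF is_testD(1)[OF t] is_test_zero_outside(1)[OF t]])
  show "L2_on \<Omega> (\<lambda>x. g x \<bullet> i)"
  proof (rule *)
    show "continuous_on UNIV (\<lambda>x. g x \<bullet> i)"
      by (intro continuous_intros is_testD(2)[OF t])
    show "g x \<bullet> i = 0" if "x \<notin> closure {x. \<phi> x \<noteq> 0}" for x
      by (simp only: is_test_zero_outside(2)[OF t that] inner_zero_left)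
  qed
qed

lemma L2_on_mult_integrable:
  assumes "L2_on \<Omega> u" "L2_on \<Omega> v"
  shows "set_integrable lebesgue \<Omega> (\<lambda>x. u x * v x)"
proof (rule set_integrable_bound)
  show "set_integrable lebesgue \<Omega> (\<lambda>x. (u x)^2 + (v x)^2)"
    using assms by (intro set_integral_add) (auto simp: L2_on_def)
  have "(\<lambda>x. (indicator \<Omega> x *\<^sub>R u x) * (indicator \<Omega> x *\<^sub>R v x)) \<in> borel_measurable lebesgue"
    using assms by (intro borel_measurable_times) (auto simp: L2_on_def set_borel_measurable_def)
  also have "(\<lambda>x. (indicator \<Omega> x *\<^sub>R u x) * (indicator \<Omega> x *\<^sub>R v x))
      = (\<lambda>x. indicator \<Omega> x *\<^sub>R (u x * v x))" by (auto simp: indicator_def)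
  finally show "set_borel_measurable lebesgue \<Omega> (\<lambda>x. u x * v x)"
    by (simp add: set_borel_measurable_def)
  have "norm (u x * v x) \<le> norm ((u x)^2 + (v x)^2)" for x
  proof -
    have "2 * (\<bar>u x\<bar> * \<bar>v x\<bar>) \<le> \<bar>u x\<bar>^2 + \<bar>v x\<bar>^2" using sum_squares_bound[of "\<bar>u x\<bar>" "\<bar>v x\<bar>"] by simp
    moreover have "\<bar>u x\<bar> * \<bar>v x\<bar> \<ge> 0" by simp
    ultimately have "\<bar>u x\<bar> * \<bar>v x\<bar> \<le> \<bar>u x\<bar>^2 + \<bar>v x\<bar>^2" by linarith
    then show ?thesis by (simp add: abs_mult)
  qed
  then show "AE x in lebesgue. x \<in> \<Omega> \<longrightarrow> norm (u x * v x) \<le> norm ((u x)^2 + (v x)^2)" by simp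
qed

lemma L2_on_diff:
  assumes "L2_on \<Omega> u" "L2_on \<Omega> v"
  shows "L2_on \<Omega> (\<lambda>x. u x - v x)"
proof -
  have "set_integrable lebesgue \<Omega> (\<lambda>x. (u x)^2 + (v x)^2 - 2 * (u x * v x))"
    using assms L2_on_mult_integrable[OF assms]
    by (intro set_integral_diff set_integral_add set_integrable_mult_right) (auto simp: L2_on_def)
  moreover have "(u x)^2 + (v x)^2 - 2 * (u x * v x) = (u x - v x)^2" for x
    by (simp add: power2_eq_square algebra_simps)
  moreover have "(\<lambda>x. indicator \<Omega> x *\<^sub>R u x - indicator \<Omega> x *\<^sub>R v x) \<in> borel_measurable lebesgue"
    using assms by (intro borel_measurable_diff) (auto simp: L2_on_def set_borel_measurable_def)
  ultimately show ?thesis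
    by (simp add: L2_on_def set_borel_measurable_def right_diff_distrib)
qed

lemma L2_on_mult_left:
  assumes "L2_on \<Omega> u"
  shows "L2_on \<Omega> (\<lambda>x. c * u x)"
proof -
  have "(\<lambda>x. c * (indicator \<Omega> x *\<^sub>R u x)) \<in> borel_measurable lebesgue"
    using assms by (intro borel_measurable_times) (auto simp: L2_on_def set_borel_measurable_def)
  then show ?thesis
    using assms by (auto simp: L2_on_def set_borel_measurable_def power_mult_distrib mult.left_commute)
qed

lemma set_integrable_norm_square:
  fixes G :: "'a::euclidean_space \<Rightarrow> 'a"
  assumes "\<And>i. i \<in> Basis \<Longrightarrow> L2_on \<Omega> (\<lambda>x. G x \<bullet> i)"
  shows "set_integrable lebesgue \<Omega> (\<lambda>x. (norm (G x))^2)"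
proof -
  have "(norm v)^2 = (\<Sum>i\<in>Basis. (v \<bullet> i)^2)" for v :: 'a
    unfolding power2_norm_eq_inner by (subst euclidean_inner) (simp add: power2_eq_square)
  then show ?thesis
    using assms unfolding L2_on_def set_integrable_def
    by (simp only: scaleR_sum_right) (intro Bochner_Integration.integrable_sum, blast)
qed

text \<open>Approximating test functions have bounded H1 norms, hence bounded integrals of the cube;
  a subsequence converges almost everywhere on \<Omega>, and Fatou's lemma transfers the bound to
  \<open>u\<close>.\<close>

lemma H01_grad_L3:
  fixes \<Omega> :: "'a::euclidean_space set"
  assumes dim: "DIM('a) \<le> 3" and "open \<Omega>" and H: "H01_grad \<Omega> u G"
  shows "set_integrable lebesgue \<Omega> (\<lambda>x. \<bar>u x\<bar>^3)"
proof -
  have \<Omega>[measurable]: "\<Omega> \<in> sets lebesgue" using \<open>open \<Omega>\<close> by simp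
  obtain \<phi>s gs where t: "\<And>k. is_test \<Omega> (\<phi>s k) (gs k)" and lim:
    "(\<lambda>k. LINT x:\<Omega>|lebesgue. (\<phi>s k x - u x)^2 + (norm (gs k x - G x))^2) \<longlonglongrightarrow> 0"
    using H by (auto simp: H01_grad_def)
  have L2u: "L2_on \<Omega> u" and L2G: "\<And>i. i \<in> Basis \<Longrightarrow> L2_on \<Omega> (\<lambda>x. G x \<bullet> i)"
    using H by (auto simp: H01_grad_def weak_grad_def)
  have \<phi>m[measurable]: "\<phi>s k \<in> borel_measurable lebesgue" for k
    using is_testD(1)[OF t] by (intro measurable_completion) (simp add: borel_measurable_continuous_onI)
  define e where "e k x = indicator \<Omega> x * ((\<phi>s k x - u x)^2 + (norm (gs k x - G x))^2)" for k x
  have e_int: "integrable lebesgue (e k)" for k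
  proof -
    have "set_integrable lebesgue \<Omega> (\<lambda>x. (\<phi>s k x - u x)^2 + (norm (gs k x - G x))^2)"
      using L2_on_diff[OF is_test_L2_on(1)[OF \<open>open \<Omega>\<close> t[of k]] L2u]
        L2_on_diff[OF is_test_L2_on(2)[OF \<open>open \<Omega>\<close> t[of k]] L2G]
      by (intro set_integral_add set_integrable_norm_square) (auto simp: L2_on_def inner_diff_left)
    then show ?thesis by (simp add: set_integrable_def e_def[abs_def])
  qed
  have e_nn: "e k x \<ge> 0" for k x by (simp add: e_def)
  have e_lim: "(\<lambda>k. \<integral>x. e k x \<partial>lebesgue) \<longlonglongrightarrow> 0"
    using lim by (simp add: set_lebesgue_integral_def e_def)
  then have "(\<lambda>k. \<integral>x. norm (e k x) \<partial>lebesgue) \<longlonglongrightarrow> 0" by (simp add: e_nn)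
  \<comment> \<open>Convergence in L1 gives almost everywhere convergence only along a subsequence,
    which suffices for Fatou.\<close>
  from tendsto_L1_AE_subseq[OF e_int this] obtain r where r: "strict_mono r"
    and ae: "AE x in lebesgue. (\<lambda>n. e (r n) x) \<longlonglongrightarrow> 0" by auto
  define m where "m x = indicator \<Omega> x * ((u x)^2 + (norm (G x))^2)" for x
  have m_int: "integrable lebesgue m"
  proof -
    have "set_integrable lebesgue \<Omega> (\<lambda>x. (u x)^2 + (norm (G x))^2)"
      using L2u L2G by (intro set_integral_add set_integrable_norm_square) (auto simp: L2_on_def)
    then show ?thesis by (simp add: set_integrable_def m_def[abs_def])
  qed
  have m_nn: "m x \<ge> 0" for x by (simp add: m_def)
  obtain E where E: "\<And>k. (\<integral>x. e k x \<partial>lebesgue) \<le> E"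
    using convergent_imp_Bseq[OF convergentI[OF e_lim]] unfolding Bseq_def
    by (metis abs_le_D1 real_norm_def)
  \<comment> \<open>A bound for the squared H1 norms, uniform in \<open>k\<close>. The maximum with
    0 keeps it nonnegative, so that sums and powers pass through \<open>ennreal\<close>.\<close>
  define C where "C = max 0 (2 * E + 2 * (\<integral>x. m x \<partial>lebesgue))"
  have "C \<ge> 0" by (simp add: C_def)
  have bound: "(\<integral>\<^sup>+x. ennreal ((\<phi>s k x)^2 + (norm (gs k x))^2) \<partial>lborel) \<le> ennreal C" for k
  proof -
    have "(\<phi>s k x)^2 + (norm (gs k x))^2 \<le> 2 * e k x + 2 * m x" for x
    proof (cases "x \<in> \<Omega>")
      \<comment> \<open>The support lies in \<Omega>, so whole-space norms of test functions are
        controlled by integrals over \<Omega>.\<close>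
      case False
      then have "x \<notin> closure {x. \<phi>s k x \<noteq> 0}" using t[of k] by (auto simp: is_test_def)
      then have "\<phi>s k x = 0" "gs k x = 0" by (rule is_test_zero_outside[OF t])+
      then show ?thesis using False by (simp add: e_def m_def)
    next
      case True
      have *: "(norm a)^2 \<le> 2 * (norm (a - b))^2 + 2 * (norm b)^2" for a b :: "'b::real_inner"
      proof -
        have "2 * (norm (a - b))^2 + 2 * (norm b)^2 - (norm a)^2 = (norm (a - 2 *\<^sub>R b))^2"
          by (simp add: power2_norm_eq_inner algebra_simps inner_commute)
        moreover have "\<dots> \<ge> 0" by simp
        ultimately show ?thesis by linarith
      qed
      show ?thesis
        using *[of "gs k x" "G x"] *[of "\<phi>s k x" "u x"] True by (simp add: e_def m_def)
    qed
    then have "(\<integral>\<^sup>+x. ennreal ((\<phi>s k x)^2 + (norm (gs k x))^2) \<partial>lebesgue)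
       \<le> (\<integral>\<^sup>+x. ennreal (2 * e k x + 2 * m x) \<partial>lebesgue)"
      by (intro nn_integral_mono ennreal_leI)
    also have "\<dots> = ennreal (\<integral>x. 2 * e k x + 2 * m x \<partial>lebesgue)"
      using e_int[of k] m_int e_nn[of k] m_nn by (intro nn_integral_eq_integral) auto
    also have "(\<integral>x. 2 * e k x + 2 * m x \<partial>lebesgue) = 2 * (\<integral>x. e k x \<partial>lebesgue) + 2 * (\<integral>x. m x \<partial>lebesgue)"
      using e_int m_int by simp
    also have "ennreal \<dots> \<le> ennreal C"
      using E[of k] by (intro ennreal_leI) (simp add: C_def)
    finally show ?thesis by (simp add: nn_integral_completion)
  qed
  have L3: "(\<integral>\<^sup>+x. ennreal (\<bar>\<phi>s k x\<bar>^3) \<partial>lebesgue) \<le> ennreal (1 + C + C^2 + C^3)" for k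
  proof -
    let ?M = "(\<integral>\<^sup>+x. ennreal ((\<phi>s k x)^2 + (norm (gs k x))^2) \<partial>lborel)"
    have "(\<integral>\<^sup>+x. ennreal (\<bar>\<phi>s k x\<bar>^3) \<partial>lebesgue) \<le> 1 + ?M + ?M^2 + ?M^3"
      using is_test_L3_bound[OF dim t[of k]] by (simp add: nn_integral_completion)
    also have "\<dots> \<le> 1 + ennreal C + ennreal C^2 + ennreal C^3"
      by (intro add_mono power_mono bound) auto
    also have "\<dots> = ennreal (1 + C + C^2 + C^3)"
      using \<open>C \<ge> 0\<close> by (simp add: ennreal_power)
    finally show ?thesis .
  qed
  have "set_borel_measurable lebesgue \<Omega> u" using L2u by (simp add: L2_on_def)
  then have [measurable]: "(\<lambda>x. indicator \<Omega> x * u x) \<in> borel_measurable lebesgue"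
    by (simp add: set_borel_measurable_def)
  have eq: "(\<lambda>x. indicator \<Omega> x *\<^sub>R \<bar>u x\<bar>^3) = (\<lambda>x. \<bar>indicator \<Omega> x * u x\<bar>^3)"
    by (rule ext) (simp split: split_indicator)
  have "(\<integral>\<^sup>+x. ennreal (\<bar>indicator \<Omega> x * u x\<bar>^3) \<partial>lebesgue)
    \<le> (\<integral>\<^sup>+x. liminf (\<lambda>n. ennreal (\<bar>\<phi>s (r n) x\<bar>^3)) \<partial>lebesgue)"
  proof (rule nn_integral_mono_AE, use ae in eventually_elim)
    fix x assume l: "(\<lambda>n. e (r n) x) \<longlonglongrightarrow> 0"
    show "ennreal (\<bar>indicator \<Omega> x * u x\<bar>^3) \<le> liminf (\<lambda>n. ennreal (\<bar>\<phi>s (r n) x\<bar>^3))"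
    proof (cases "x \<in> \<Omega>")
      case True
      have "(\<lambda>n. (\<phi>s (r n) x - u x)^2) \<longlonglongrightarrow> 0"
        by (rule tendsto_sandwich[OF _ _ tendsto_const l]) (use True in \<open>auto simp: e_def\<close>)
      then have "(\<lambda>n. sqrt ((\<phi>s (r n) x - u x)^2)) \<longlonglongrightarrow> sqrt 0" by (rule tendsto_real_sqrt)
      then have "(\<lambda>n. \<phi>s (r n) x - u x) \<longlonglongrightarrow> 0" by (simp add: tendsto_rabs_zero_iff)
      then have "(\<lambda>n. \<phi>s (r n) x) \<longlonglongrightarrow> u x" by (simp add: LIM_zero_iff)
      then have "(\<lambda>n. ennreal (\<bar>\<phi>s (r n) x\<bar>^3)) \<longlonglongrightarrow> ennreal (\<bar>u x\<bar>^3)"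
        by (intro tendsto_ennrealI tendsto_power tendsto_rabs)
      then have "liminf (\<lambda>n. ennreal (\<bar>\<phi>s (r n) x\<bar>^3)) = ennreal (\<bar>u x\<bar>^3)"
        by (intro lim_imp_Liminf) auto
      then show ?thesis using True by simp
    qed simp
  qed
  also have "\<dots> \<le> liminf (\<lambda>n. \<integral>\<^sup>+x. ennreal (\<bar>\<phi>s (r n) x\<bar>^3) \<partial>lebesgue)"
    by (rule nn_integral_liminf) measurable
  also have "\<dots> \<le> liminf (\<lambda>n::nat. ennreal (1 + C + C^2 + C^3))"
    by (intro Liminf_mono always_eventually allI L3)
  also have "\<dots> < top" by (simp add: Liminf_const)
  finally have "(\<integral>\<^sup>+x. ennreal (\<bar>indicator \<Omega> x * u x\<bar>^3) \<partial>lebesgue) < top" .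
  then have "integrable lebesgue (\<lambda>x. \<bar>indicator \<Omega> x * u x\<bar>^3)"
    by (intro integrableI_bounded) auto
  then show ?thesis unfolding set_integrable_def eq .
qed

section \<open>Synchronized amplitudes\<close>

text \<open>Uses \<open>\<beta> / (\<mu> j - \<beta>) = \<mu> j / (\<mu> j - \<beta>) - 1\<close>.
  Now \<beta> occurs only in denominators, so monotonicity and bounds can be read off summand by
  summand.\<close>

lemma gfun_alt:
  assumes "\<And>j. j \<in> {1..n} \<Longrightarrow> \<mu> j \<noteq> \<beta>"
  shows "gfun n \<mu> \<beta> = 1 - real n + (\<Sum>j=1..n. \<mu> j / (\<mu> j - \<beta>))"
proof -
  have "(\<Sum>j=1..n. \<mu> j / (\<mu> j - \<beta>)) = (\<Sum>j=1..n. 1 + \<beta> * (1 / (\<mu> j - \<beta>)))"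
    using assms by (intro sum.cong) (auto simp: field_simps)
  then show ?thesis by (simp add: gfun_def sum.distrib sum_distrib_left)
qed

lemma continuous_on_gfun:
  assumes "\<And>j \<beta>. j \<in> {1..n} \<Longrightarrow> \<beta> \<in> S \<Longrightarrow> \<mu> j \<noteq> \<beta>"
  shows "continuous_on S (gfun n \<mu>)"
  unfolding gfun_def[abs_def] using assms by (intro continuous_intros) force+

text \<open>On the nonpositive half-line g increases strictly, from a value at most 0 at minus the
  largest \<open>\<mu> j\<close> up to 1 at 0. So it has exactly one negative zero, which identifies
  the definite description.\<close>

lemma beta_bar_focusing:
  assumes n: "n \<ge> 2" and pos: "\<And>j. j \<in> {1..n} \<Longrightarrow> \<mu> j > 0"
  shows "beta_bar n \<mu> < 0" "\<And>\<beta>. \<beta> < beta_bar n \<mu> \<Longrightarrow> gfun n \<mu> \<beta> < 0"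
proof -
  have mono: "gfun n \<mu> b < gfun n \<mu> c" if "b < c" "c \<le> 0" for b c
  proof -
    have "(\<Sum>j=1..n. \<mu> j / (\<mu> j - b)) < (\<Sum>j=1..n. \<mu> j / (\<mu> j - c))"
    proof (rule sum_strict_mono)
      fix j assume "j \<in> {1..n}"
      then have "\<mu> j > 0" by (rule pos)
      then show "\<mu> j / (\<mu> j - b) < \<mu> j / (\<mu> j - c)"
        using that by (intro divide_strict_left_mono mult_pos_pos) auto
    qed (use n in auto)
    moreover have ne: "\<mu> j \<noteq> b" "\<mu> j \<noteq> c" if "j \<in> {1..n}" for j
      using pos[OF that] \<open>b < c\<close> \<open>c \<le> 0\<close> by auto
    ultimately show ?thesis using gfun_alt[of n \<mu> b, OF ne(1)] gfun_alt[of n \<mu> c, OF ne(2)] by simp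
  qed
  \<comment> \<open>At \<open>-m\<close> every quotient \<open>\<mu> j / (\<mu> j + m)\<close> is at
    most 1/2, so g is at most \<open>1 - n / 2\<close>, and \<open>n \<ge> 2\<close> makes this
    nonpositive.\<close>
  define m where "m = Max (\<mu> ` {1..n})"
  have m: "\<mu> j \<le> m" if "j \<in> {1..n}" for j unfolding m_def using that by auto
  have m0: "m > 0" using m[of 1] pos[of 1] n by auto
  have "(\<Sum>j=1..n. \<mu> j / (\<mu> j - (-m))) \<le> (\<Sum>j=1..n. 1/2)"
  proof (rule sum_mono)
    fix j assume "j \<in> {1..n}"
    then show "\<mu> j / (\<mu> j - (-m)) \<le> 1/2" using m[of j] pos[of j] m0 by (simp add: field_simps)
  qed
  moreover have "\<mu> j \<noteq> -m" if "j \<in> {1..n}" for j using pos[OF that] m0 by auto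
  ultimately have "gfun n \<mu> (-m) \<le> 1 - real n + real n / 2" by (subst gfun_alt) auto
  then have "gfun n \<mu> (-m) \<le> 0" using n by simp
  moreover have "gfun n \<mu> 0 \<ge> 0" by (simp add: gfun_def)
  moreover have "continuous_on {-m..0} (gfun n \<mu>)"
    by (rule continuous_on_gfun) (use pos in force)
  ultimately obtain z where z: "-m \<le> z" "z \<le> 0" "gfun n \<mu> z = 0"
    using IVT'[of "gfun n \<mu>" "-m" 0 0] m0 by auto
  moreover have "z \<noteq> 0" using z by (auto simp: gfun_def)
  ultimately have z: "z < 0" "gfun n \<mu> z = 0" by auto
  have "focusing n \<mu>" using pos[of 1] n by (simp add: focusing_def)
  moreover have "(THE b. b < 0 \<and> gfun n \<mu> b = 0) = z"
  proof (rule the_equality)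
    fix b assume "b < 0 \<and> gfun n \<mu> b = 0"
    then show "b = z" using mono[of b z] mono[of z b] z by (cases b z rule: linorder_cases) auto
  qed (use z in simp)
  ultimately have "beta_bar n \<mu> = z" by (simp add: beta_bar_def)
  then show "beta_bar n \<mu> < 0" "\<And>\<beta>. \<beta> < beta_bar n \<mu> \<Longrightarrow> gfun n \<mu> \<beta> < 0"
    using z mono[of _ z] by auto
qed

text \<open>Mirror image of the focusing case: to the right of \<open>\<mu> n\<close>, g decreases
  strictly, is 1 at 0 and at most 0 at the largest \<open>- \<mu> j\<close>. Its zero there is
  unique, and g is positive between \<open>\<mu> n\<close> and that zero.\<close>

lemma beta_bar_defocusing:
  assumes n: "n \<ge> 2" and neg: "\<mu> n < 0" and le: "\<And>j. j \<in> {1..n} \<Longrightarrow> \<mu> j \<le> \<mu> n"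
    and \<beta>: "\<mu> n < \<beta>" "\<beta> < beta_bar n \<mu>"
  shows "gfun n \<mu> \<beta> > 0"
proof -
  have mono: "gfun n \<mu> c < gfun n \<mu> b" if "\<mu> n < b" "b < c" for b c
  proof -
    have "(\<Sum>j=1..n. \<mu> j / (\<mu> j - c)) < (\<Sum>j=1..n. \<mu> j / (\<mu> j - b))"
    proof (rule sum_strict_mono)
      fix j assume "j \<in> {1..n}"
      then have "\<mu> j \<le> \<mu> n" by (rule le)
      then show "\<mu> j / (\<mu> j - c) < \<mu> j / (\<mu> j - b)"
        using that neg by (intro divide_strict_left_mono_neg mult_neg_neg) auto
    qed (use n in auto)
    moreover have ne: "\<mu> j \<noteq> b" "\<mu> j \<noteq> c" if "j \<in> {1..n}" for j
      using le[OF that] \<open>b < c\<close> \<open>\<mu> n < b\<close> by auto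
    ultimately show ?thesis using gfun_alt[of n \<mu> b, OF ne(1)] gfun_alt[of n \<mu> c, OF ne(2)] by simp
  qed
  define m where "m = Max ((\<lambda>j. - \<mu> j) ` {1..n})"
  have m: "- \<mu> j \<le> m" if "j \<in> {1..n}" for j unfolding m_def using that by auto
  have m0: "m > 0" using m[of n] neg n by auto
  have "(\<Sum>j=1..n. \<mu> j / (\<mu> j - m)) \<le> (\<Sum>j=1..n. 1/2)"
  proof (rule sum_mono)
    fix j assume "j \<in> {1..n}"
    then show "\<mu> j / (\<mu> j - m) \<le> 1/2" using m[of j] le[of j] neg m0 by (simp add: field_simps)
  qed
  moreover have "\<mu> j \<noteq> m" if "j \<in> {1..n}" for j using le[OF that] neg m0 by auto
  ultimately have "gfun n \<mu> m \<le> 1 - real n + real n / 2" by (subst gfun_alt) auto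
  then have "gfun n \<mu> m \<le> 0" using n by simp
  moreover have "gfun n \<mu> 0 \<ge> 0" by (simp add: gfun_def)
  moreover have "continuous_on {0..m} (gfun n \<mu>)"
    by (rule continuous_on_gfun) (use le neg in force)
  ultimately obtain z where "0 \<le> z" "z \<le> m" "gfun n \<mu> z = 0"
    using IVT2'[of "gfun n \<mu>" m 0 0] m0 by auto
  then have z: "\<mu> n < z" "gfun n \<mu> z = 0" using neg by auto
  have "\<not> focusing n \<mu>" using le[of 1] neg n by (simp add: focusing_def)
  moreover have "(THE b. \<mu> n < b \<and> gfun n \<mu> b = 0) = z"
  proof (rule the_equality)
    fix b assume "\<mu> n < b \<and> gfun n \<mu> b = 0"
    then show "b = z" using mono[of b z] mono[of z b] z by (cases b z rule: linorder_cases) auto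
  qed (use z in simp)
  ultimately have "beta_bar n \<mu> = z" by (simp add: beta_bar_def)
  then show ?thesis using z mono[of \<beta> z] \<beta> by auto
qed

text \<open>Serves the mixed cases and the lower interval of the defocusing case. The first quotient
  is nonpositive and each of the other n - 1 is below 1 because \<open>\<beta> < 0\<close>, so their
  sum stays below n - 1.\<close>

lemma gfun_neg_below:
  assumes n: "n \<ge> 2" and "\<mu> 1 \<le> 0" and ge: "\<And>j. j \<in> {1..n} \<Longrightarrow> \<mu> 1 \<le> \<mu> j" and "\<beta> < \<mu> 1"
  shows "gfun n \<mu> \<beta> < 0"
proof -
  have ne: "\<mu> j \<noteq> \<beta>" if "j \<in> {1..n}" for j using ge[OF that] assms by auto
  have "(\<Sum>j=1..n. \<mu> j / (\<mu> j - \<beta>)) = \<mu> 1 / (\<mu> 1 - \<beta>) + (\<Sum>j=2..n. \<mu> j / (\<mu> j - \<beta>))"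
    using n by (subst sum.atLeast_Suc_atMost) (auto simp: numeral_2_eq_2)
  moreover have "\<mu> 1 / (\<mu> 1 - \<beta>) \<le> 0" using assms by (simp add: divide_le_0_iff)
  moreover have "(\<Sum>j=2..n. \<mu> j / (\<mu> j - \<beta>)) < (\<Sum>j=2..n. 1)"
  proof (rule sum_strict_mono)
    fix j assume "j \<in> {2..n}"
    then have "\<mu> j - \<beta> > 0" using ge[of j] assms(4) by simp
    moreover have "\<beta> < 0" using assms by linarith
    ultimately show "\<mu> j / (\<mu> j - \<beta>) < 1" by simp
  qed (use n in auto)
  ultimately show ?thesis using n gfun_alt[of n \<mu> \<beta>, OF ne] by simp
qed

text \<open>Either \<beta> lies below all \<open>\<mu> j\<close> and g is negative, or \<beta> lies
  above all of them and g is positive. This is the positivity required of the squared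
  amplitudes.\<close>

lemma I_set_sign:
  assumes n: "n \<ge> 2"
    and mu_sorted: "\<And>i j. 1 \<le> i \<Longrightarrow> i \<le> j \<Longrightarrow> j \<le> n \<Longrightarrow> \<mu> i \<le> \<mu> j"
    and \<beta>: "\<beta> \<in> I_set n \<mu>" and j: "j \<in> {1..n}"
  shows "(\<beta> - \<mu> j) * gfun n \<mu> \<beta> > 0"
proof -
  have ge: "\<mu> 1 \<le> \<mu> i" and le: "\<mu> i \<le> \<mu> n" if "i \<in> {1..n}" for i
    using mu_sorted that by auto
  consider (foc) "focusing n \<mu>" "\<beta> < beta_bar n \<mu>"
    | (below) "\<not> focusing n \<mu>" "\<beta> < \<mu> 1"
    | (above) "\<not> focusing n \<mu>" "defocusing n \<mu>" "\<mu> n < \<beta>" "\<beta> < beta_bar n \<mu>"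
    using \<beta> by (auto simp: I_set_def split: if_splits)
  then show ?thesis
  proof cases
    case foc
    have pos: "\<mu> i > 0" if "i \<in> {1..n}" for i using foc ge[OF that] by (auto simp: focusing_def)
    have "beta_bar n \<mu> < 0" "gfun n \<mu> \<beta> < 0" using beta_bar_focusing[of n \<mu>] n pos foc by auto
    then show ?thesis using foc pos[OF j] by (intro mult_neg_neg) auto
  next
    case below
    then show ?thesis
      using gfun_neg_below[of n \<mu> \<beta>] n ge less_le_trans[OF below(2) ge[OF j]]
      by (intro mult_neg_neg) (auto simp: focusing_def)
  next
    case above
    then show ?thesis
      using beta_bar_defocusing[of n \<mu> \<beta>] n le le_less_trans[OF le[OF j] above(3)]
      by (intro mult_pos_pos) (auto simp: defocusing_def)
  qed
qed

text \<open>Row j reads \<open>(\<mu> j - \<beta>) * a j + \<beta> * s = -1\<close>, so the rows are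
  coupled only through the total \<open>s\<close>, and the system reduces to one scalar equation for
  \<open>s\<close>.\<close>

lemma synchronized_system_iff:
  fixes a :: "nat \<Rightarrow> real"
  assumes g: "gfun n \<mu> \<beta> \<noteq> 0" and ne: "\<And>j. j \<in> {1..n} \<Longrightarrow> \<beta> \<noteq> \<mu> j"
  shows "(\<forall>j\<in>{1..n}. \<mu> j * a j + \<beta> * (\<Sum>k\<in>{1..n}-{j}. a k) = -1)
    \<longleftrightarrow> (\<forall>j\<in>{1..n}. a j = 1 / ((\<beta> - \<mu> j) * gfun n \<mu> \<beta>))"
proof -
  define s where "s = (\<Sum>k=1..n. a k)"
  define S where "S = (\<Sum>k=1..n. 1 / (\<beta> - \<mu> k))"
  have gS: "gfun n \<mu> \<beta> = 1 - \<beta> * S"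
  proof -
    have "(\<Sum>k=1..n. 1 / (\<mu> k - \<beta>)) = (\<Sum>k=1..n. - (1 / (\<beta> - \<mu> k)))"
      by (intro sum.cong refl) (metis divide_minus_right minus_diff_eq)
    then show ?thesis by (simp add: gfun_def S_def sum_negf)
  qed
  have eq: "\<mu> j * a j + \<beta> * (\<Sum>k\<in>{1..n}-{j}. a k) = -1 \<longleftrightarrow> a j = (1 + \<beta> * s) * (1 / (\<beta> - \<mu> j))"
    if j: "j \<in> {1..n}" for j
  proof -
    have "(\<Sum>k\<in>{1..n}-{j}. a k) = s - a j" using j by (simp add: s_def sum_diff1)
    then show ?thesis using ne[OF j] by (auto simp: field_simps)
  qed
  show ?thesis
  proof
    assume "\<forall>j\<in>{1..n}. \<mu> j * a j + \<beta> * (\<Sum>k\<in>{1..n}-{j}. a k) = -1"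
    then have aj: "a j = (1 + \<beta> * s) * (1 / (\<beta> - \<mu> j))" if "j \<in> {1..n}" for j using eq that by blast
    have "s = (\<Sum>j=1..n. (1 + \<beta> * s) * (1 / (\<beta> - \<mu> j)))" unfolding s_def using aj
      by (intro sum.cong refl) (simp add: s_def)
    then have "s = (1 + \<beta> * s) * S" by (simp add: S_def sum_distrib_left)
    \<comment> \<open>With g written as \<open>1 - \<beta> * S\<close>, the product is
      \<open>1 + \<beta> * s - \<beta> * ((1 + \<beta> * s) * S)\<close>, and the last bracket is
      \<open>s\<close>.\<close>
    then have "(1 + \<beta> * s) * gfun n \<mu> \<beta> = 1" unfolding gS by algebra
    then have "1 + \<beta> * s = 1 / gfun n \<mu> \<beta>" using g by (simp add: field_simps)
    then show "\<forall>j\<in>{1..n}. a j = 1 / ((\<beta> - \<mu> j) * gfun n \<mu> \<beta>)" using aj by simp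
  next
    assume a: "\<forall>j\<in>{1..n}. a j = 1 / ((\<beta> - \<mu> j) * gfun n \<mu> \<beta>)"
    then have "s = (\<Sum>j=1..n. (1 / gfun n \<mu> \<beta>) * (1 / (\<beta> - \<mu> j)))" by (simp add: s_def mult.commute)
    then have "s = S / gfun n \<mu> \<beta>" unfolding sum_distrib_left[symmetric] S_def[symmetric] by simp
    then have "s * gfun n \<mu> \<beta> = S" using g by simp
    then have "(1 + \<beta> * s) * gfun n \<mu> \<beta> = gfun n \<mu> \<beta> + \<beta> * S" by (simp add: algebra_simps)
    then have "(1 + \<beta> * s) * gfun n \<mu> \<beta> = 1" using gS by simp
    then have "1 + \<beta> * s = 1 / gfun n \<mu> \<beta>" using g by (simp add: eq_divide_eq)
    then show "\<forall>j\<in>{1..n}. \<mu> j * a j + \<beta> * (\<Sum>k\<in>{1..n}-{j}. a k) = -1"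
      using a eq by simp
  qed
qed

lemma alpha_branch_square:
  assumes "(\<beta> - \<mu> j) * gfun n \<mu> \<beta> > 0"
  shows "(alpha_branch n \<mu> \<beta> j)^2 = 1 / ((\<beta> - \<mu> j) * gfun n \<mu> \<beta>)" "alpha_branch n \<mu> \<beta> j > 0"
proof -
  show "alpha_branch n \<mu> \<beta> j > 0" unfolding alpha_branch_def powr_gt_zero using assms by (rule less_imp_neq[THEN not_sym])
  have "(alpha_branch n \<mu> \<beta> j)^2 = ((\<beta> - \<mu> j) * gfun n \<mu> \<beta>) powr (-1)"
    unfolding alpha_branch_def power2_eq_square powr_add[symmetric] by simp
  then show "(alpha_branch n \<mu> \<beta> j)^2 = 1 / ((\<beta> - \<mu> j) * gfun n \<mu> \<beta>)"
    using powr_minus_divide[of "(\<beta> - \<mu> j) * gfun n \<mu> \<beta>" 1] powr_one[OF less_imp_le[OF assms]] by simp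
qed

section \<open>Scaling and uniqueness for weak solutions\<close>

text \<open>Any compact set between the nonzero set and \<Omega> may replace the closure, which
  spares computing exact supports.\<close>

lemma is_testI:
  assumes "\<And>x. (\<phi> has_derivative (\<lambda>h. g x \<bullet> h)) (at x)" "continuous_on UNIV g"
    and "compact K" "K \<subseteq> \<Omega>" "{x. \<phi> x \<noteq> 0} \<subseteq> K"
  shows "is_test \<Omega> \<phi> g"
proof -
  have "closure {x. \<phi> x \<noteq> 0} \<subseteq> K"
    using assms(3,5) by (simp add: closure_minimal compact_imp_closed)
  moreover have "compact (closure {x. \<phi> x \<noteq> 0})"
    using assms(3) calculation compact_closure bounded_subset compact_imp_bounded closure_subset
    by (metis (no_types, lifting) assms(5))
  ultimately show ?thesis using assms by (auto simp: is_test_def)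
qed

lemma is_test_scale:
  assumes "is_test \<Omega> \<phi> g"
  shows "is_test \<Omega> (\<lambda>x. c * \<phi> x) (\<lambda>x. c *\<^sub>R g x)"
proof (rule is_testI[where K = "closure {x. \<phi> x \<noteq> 0}"])
  show "((\<lambda>x. c * \<phi> x) has_derivative (\<lambda>h. (c *\<^sub>R g x) \<bullet> h)) (at x)" for x
    using has_derivative_mult_right[OF is_testD(3)[OF assms], of c] by simp
  show "continuous_on UNIV (\<lambda>x. c *\<^sub>R g x)" by (intro continuous_intros is_testD(2)[OF assms])
  show "{x. c * \<phi> x \<noteq> 0} \<subseteq> closure {x. \<phi> x \<noteq> 0}"
    using closure_subset[of "{x. \<phi> x \<noteq> 0}"] by auto
qed (use assms in \<open>auto simp: is_test_def\<close>)

lemma weak_grad_scale: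
  assumes "weak_grad \<Omega> u G"
  shows "weak_grad \<Omega> (\<lambda>x. c * u x) (\<lambda>x. c *\<^sub>R G x)"
  unfolding weak_grad_def
proof (intro conjI ballI allI impI)
  show "L2_on \<Omega> (\<lambda>x. c * u x)" using assms by (simp add: weak_grad_def L2_on_mult_left)
  show "L2_on \<Omega> (\<lambda>x. (c *\<^sub>R G x) \<bullet> i)" if "i \<in> Basis" for i
    using assms that by (simp add: weak_grad_def L2_on_mult_left)
  fix \<phi> g assume t: "is_test \<Omega> \<phi> g"
  have "(LINT x:\<Omega>|lebesgue. (c * u x) *\<^sub>R g x) = c *\<^sub>R (LINT x:\<Omega>|lebesgue. u x *\<^sub>R g x)"
    by (simp flip: scaleR_scaleR)
  also have "\<dots> = - (c *\<^sub>R (LINT x:\<Omega>|lebesgue. \<phi> x *\<^sub>R G x))"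
    using assms t by (simp add: weak_grad_def)
  also have "\<dots> = - (LINT x:\<Omega>|lebesgue. \<phi> x *\<^sub>R c *\<^sub>R G x)"
    by (simp only: scaleR_left_commute[of _ c] set_integral_scaleR_right)
  finally show "(LINT x:\<Omega>|lebesgue. (c * u x) *\<^sub>R g x)
      = - (LINT x:\<Omega>|lebesgue. \<phi> x *\<^sub>R c *\<^sub>R G x)" .
qed

lemma H01_grad_scale:
  assumes "H01_grad \<Omega> u G"
  shows "H01_grad \<Omega> (\<lambda>x. c * u x) (\<lambda>x. c *\<^sub>R G x)"
proof -
  obtain \<phi>s gs where t: "\<And>k. is_test \<Omega> (\<phi>s k) (gs k)" and lim:
    "(\<lambda>k. LINT x:\<Omega>|lebesgue. (\<phi>s k x - u x)^2 + (norm (gs k x - G x))^2) \<longlonglongrightarrow> 0"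
    using assms by (auto simp: H01_grad_def)
  have "(c * \<phi>s k x - c * u x)^2 + (norm (c *\<^sub>R gs k x - c *\<^sub>R G x))^2
      = c^2 * ((\<phi>s k x - u x)^2 + (norm (gs k x - G x))^2)" for k x
    by (simp add: power_mult_distrib distrib_left flip: right_diff_distrib scaleR_diff_right)
  then have "(\<lambda>k. LINT x:\<Omega>|lebesgue. (c * \<phi>s k x - c * u x)^2 + (norm (c *\<^sub>R gs k x - c *\<^sub>R G x))^2) \<longlonglongrightarrow> 0"
    using tendsto_mult_right_zero[OF lim, of "c^2"] by simp
  then show ?thesis
    using assms weak_grad_scale[of \<Omega> u G c] is_test_scale[OF t, of c] unfolding H01_grad_def
    by (intro conjI exI[of _ "\<lambda>k x. c * \<phi>s k x"] exI[of _ "\<lambda>k x. c *\<^sub>R gs k x"] allI) blast+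
qed

text \<open>The left-hand side is linear in \<open>u\<close> and its gradient, and a constant factor
  leaves a Bochner integral whether or not that integral exists. The right-hand sides are compared
  only on \<Omega>, where the equation is tested.\<close>

lemma weak_sol_scale:
  assumes "weak_sol \<Omega> F u" and F': "\<And>x. x \<in> \<Omega> \<Longrightarrow> F' x = c * F x"
  shows "weak_sol \<Omega> F' (\<lambda>x. c * u x)"
proof -
  obtain G where G: "H01_grad \<Omega> u G" and sol: "\<And>\<phi> g. is_test \<Omega> \<phi> g \<Longrightarrow>
      (LINT x:\<Omega>|lebesgue. G x \<bullet> g x - u x * \<phi> x) = (LINT x:\<Omega>|lebesgue. F x * \<phi> x)"
    using assms(1) by (auto simp: weak_sol_def)
  have "(LINT x:\<Omega>|lebesgue. (c *\<^sub>R G x) \<bullet> g x - c * u x * \<phi> x) = (LINT x:\<Omega>|lebesgue. F' x * \<phi> x)"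
    if "is_test \<Omega> \<phi> g" for \<phi> g
  proof -
    have "(LINT x:\<Omega>|lebesgue. (c *\<^sub>R G x) \<bullet> g x - c * u x * \<phi> x)
        = (LINT x:\<Omega>|lebesgue. c * (G x \<bullet> g x - u x * \<phi> x))"
      by (simp only: inner_scaleR_left right_diff_distrib mult.assoc)
    also have "\<dots> = (LINT x:\<Omega>|lebesgue. c * (F x * \<phi> x))"
      by (simp only: set_integral_mult_right sol[OF that])
    also have "\<dots> = (LINT x:\<Omega>|lebesgue. F' x * \<phi> x)"
      unfolding set_lebesgue_integral_def
      by (intro Bochner_Integration.integral_cong refl) (auto simp: F' indicator_def)
    finally show ?thesis .
  qed
  then show ?thesis using H01_grad_scale[OF G, of c] by (auto simp: weak_sol_def)
qed

section \<open>A twice continuously differentiable bump function\<close>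

lemma DERIV_max_0_power2:
  "((\<lambda>t::real. (max 0 t)^2) has_real_derivative 2 * max 0 t) (at t)"
proof (cases t "0::real" rule: linorder_cases)
  case less
  have "((\<lambda>t::real. 0) has_real_derivative 2 * max 0 t) (at t)" using less by simp
  then show ?thesis
    by (rule has_field_derivative_transform_within_open[of _ _ _ "{..<0}"]) (use less in auto)
next
  case equal
  \<comment> \<open>Caratheodory's criterion at the kink:
    \<open>(max 0 z)^2 = max 0 z * (z - 0)\<close>, and the slope \<open>max 0\<close> is
    continuous.\<close>
  then show ?thesis
    by (subst CARAT_DERIV, intro exI[of _ "max 0"])
       (auto simp: max_def power2_eq_square intro!: continuous_intros)
next
  case greater
  have "((\<lambda>t::real. t^2) has_real_derivative 2 * max 0 t) (at t)"
    using greater by (auto intro!: derivative_eq_intros)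
  then show ?thesis
    by (rule has_field_derivative_transform_within_open[of _ _ _ "{0<..}"]) (use greater in auto)
qed

text \<open>Product rule for \<open>t * (max 0 t)^2\<close>, which equals \<open>(max 0 t)^3\<close>
  for either sign of \<open>t\<close>.\<close>

lemma DERIV_max_0_power3:
  "((\<lambda>t::real. (max 0 t)^3) has_real_derivative 3 * (max 0 t)^2) (at t)"
proof -
  have "((\<lambda>t::real. t * (max 0 t)^2) has_real_derivative 1 * (max 0 t)^2 + (2 * max 0 t) * t) (at t)"
    by (rule DERIV_mult[OF DERIV_ident DERIV_max_0_power2])
  moreover have "1 * (max 0 t)^2 + (2 * max 0 t) * t = 3 * (max 0 t)^2"
    by (simp add: max_def power2_eq_square)
  moreover have "(\<lambda>t::real. t * (max 0 t)^2) = (\<lambda>t. (max 0 t)^3)"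
    by (rule ext) (simp add: max_def power3_eq_cube power2_eq_square)
  ultimately show ?thesis by (simp only:)
qed

text \<open>Two derivatives are needed so that the components of the gradient are test functions again;
  this pins down \<open>\<integral>G \<bullet> g\<close> without showing that weak gradients are unique almost everywhere.\<close>

lemma ex_C2_bump:
  fixes x0 :: "'a::euclidean_space"
  assumes "open \<Omega>" "x0 \<in> \<Omega>"
  obtains \<phi> g r where "r > 0" "is_test \<Omega> \<phi> g" "\<And>i. \<exists>g'. is_test \<Omega> (\<lambda>x. g x \<bullet> i) g'"
    "\<And>x. \<phi> x \<ge> 0" "ball x0 r \<subseteq> \<Omega>" "\<And>x. x \<in> ball x0 r \<Longrightarrow> \<phi> x > 0"
proof -
  obtain r where r: "r > 0" "cball x0 r \<subseteq> \<Omega>" using assms open_contains_cball by blast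
  \<comment> \<open>The bump is the cube of the positive part of \<open>b\<close>. Its gradient
    carries the factor \<open>(m x)^2\<close>, whose derivative still has the continuous factor
    \<open>m x\<close>.\<close>
  define b where "b x = r^2 - (x - x0) \<bullet> (x - x0)" for x
  define m where "m x = max 0 (b x)" for x
  have b: "(b has_derivative (\<lambda>h. - 2 * ((x - x0) \<bullet> h))) (at x)" for x
    unfolding b_def by (auto intro!: derivative_eq_intros simp: inner_commute)
  have cm: "continuous_on UNIV m" unfolding m_def b_def by (intro continuous_intros)
  have m2: "((\<lambda>x. (m x)^2) has_derivative (\<lambda>h. 2 * m x * (- 2 * ((x - x0) \<bullet> h)))) (at x)" for x
    unfolding m_def using DERIV_max_0_power2[THEN has_field_derivative_imp_has_derivative]
    by (rule has_derivative_compose[OF b])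
  have m3: "((\<lambda>x. (m x)^3) has_derivative (\<lambda>h. 3 * (m x)^2 * (- 2 * ((x - x0) \<bullet> h)))) (at x)" for x
    unfolding m_def using DERIV_max_0_power3[THEN has_field_derivative_imp_has_derivative]
    by (rule has_derivative_compose[OF b])
  have m_pos: "m x > 0 \<longleftrightarrow> x \<in> ball x0 r" for x
  proof -
    have "m x > 0 \<longleftrightarrow> (dist x0 x)^2 < r^2"
      by (auto simp: m_def b_def dist_commute[of x0] dist_norm[of x] power2_norm_eq_inner)
    also have "\<dots> \<longleftrightarrow> dist x0 x < r" using r power_less_imp_less_base[of "dist x0 x" 2 r] by (auto intro: power_strict_mono)
    finally show ?thesis by simp
  qed
  have m0: "m x \<ge> 0" for x by (simp add: m_def)
  have supp: "x \<in> cball x0 r" if "m x \<noteq> 0" for x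
    using m_pos[of x] m0[of x] that by (auto simp: less_le)
  define g where "g x = (- 6 * (m x)^2) *\<^sub>R (x - x0)" for x
  show ?thesis
  proof (rule that[of r "\<lambda>x. (m x)^3" g])
    show "is_test \<Omega> (\<lambda>x. (m x)^3) g"
    proof (rule is_testI[OF _ _ compact_cball r(2)])
      show "((\<lambda>x. (m x)^3) has_derivative (\<lambda>h. g x \<bullet> h)) (at x)" for x
        using m3[of x] by (simp add: g_def mult.assoc)
      show "continuous_on UNIV g" unfolding g_def by (intro continuous_intros cm)
      show "{x. (m x)^3 \<noteq> 0} \<subseteq> cball x0 r" using supp by fastforce
    qed
    show "\<exists>g'. is_test \<Omega> (\<lambda>x. g x \<bullet> i) g'" for i
    proof (rule exI, rule is_testI[OF _ _ compact_cball r(2)])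
      \<comment> \<open>Product rule: 24 is -6 times 2 times -2, from differentiating
        \<open>-6 * (m x)^2\<close>, and \<open>i\<close> is the gradient of
        \<open>(x - x0) \<bullet> i\<close>.\<close>
      let ?g' = "\<lambda>x. (24 * m x * ((x - x0) \<bullet> i)) *\<^sub>R (x - x0) + (- 6 * (m x)^2) *\<^sub>R i"
      show "((\<lambda>x. g x \<bullet> i) has_derivative (\<lambda>h. ?g' x \<bullet> h)) (at x)" for x
      proof -
        have "((\<lambda>x. - 6 * (m x)^2 * ((x - x0) \<bullet> i)) has_derivative
          (\<lambda>h. - 6 * (m x)^2 * (h \<bullet> i) + - 6 * (2 * m x * (- 2 * ((x - x0) \<bullet> h))) * ((x - x0) \<bullet> i))) (at x)"
          by (rule has_derivative_mult[OF has_derivative_mult_right[OF m2]])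
             (auto intro!: derivative_eq_intros)
        then show ?thesis by (simp add: g_def algebra_simps inner_commute)
      qed
      show "continuous_on UNIV ?g'" by (intro continuous_intros cm)
      show "{x. g x \<bullet> i \<noteq> 0} \<subseteq> cball x0 r" using supp by (fastforce simp: g_def)
    qed
    show "ball x0 r \<subseteq> \<Omega>" using r ball_subset_cball by blast
  qed (use r m0 m_pos in auto)
qed

section \<open>Right-hand sides are determined by the solution\<close>

lemma set_integrable_componentwise:
  fixes f :: "'a::euclidean_space \<Rightarrow> 'b::euclidean_space"
  assumes "\<And>i. i \<in> Basis \<Longrightarrow> set_integrable M A (\<lambda>x. f x \<bullet> i)"
  shows "set_integrable M A f"
proof -
  have "integrable M (\<lambda>x. \<Sum>i\<in>Basis. (indicator A x *\<^sub>R (f x \<bullet> i)) *\<^sub>R i)"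
    using assms by (intro Bochner_Integration.integrable_sum integrable_scaleR_left) (auto simp: set_integrable_def)
  also have "(\<lambda>x. \<Sum>i\<in>Basis. (indicator A x *\<^sub>R (f x \<bullet> i)) *\<^sub>R i) = (\<lambda>x. indicator A x *\<^sub>R f x)"
    by (simp add: euclidean_representation flip: scaleR_scaleR scaleR_sum_right)
  finally show ?thesis by (simp add: set_integrable_def)
qed

text \<open>The components of \<open>g\<close> serve as test functions in the definition of the weak
  gradient. This expresses the integral of \<open>G \<bullet> g\<close> through \<open>u\<close>
  alone, whichever weak gradient was chosen.\<close>

lemma weak_grad_test_integral:
  fixes \<Omega> :: "'a::euclidean_space set"
  assumes "open \<Omega>" and w: "weak_grad \<Omega> u G" and t: "is_test \<Omega> \<phi> g"
    and t2: "\<And>i. is_test \<Omega> (\<lambda>x. g x \<bullet> i) (g' i)"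
  shows "set_integrable lebesgue \<Omega> (\<lambda>x. G x \<bullet> g x)"
    and "(LINT x:\<Omega>|lebesgue. G x \<bullet> g x)
      = (\<Sum>i\<in>Basis. - ((LINT x:\<Omega>|lebesgue. u x *\<^sub>R g' i x) \<bullet> i))"
proof -
  have L2G: "L2_on \<Omega> (\<lambda>x. G x \<bullet> i)" if "i \<in> Basis" for i
    using w that by (simp add: weak_grad_def)
  have I: "set_integrable lebesgue \<Omega> (\<lambda>x. (g x \<bullet> i) * (G x \<bullet> j))" if "j \<in> Basis" for i j
    by (rule L2_on_mult_integrable[OF is_test_L2_on(2)[OF \<open>open \<Omega>\<close> t] L2G[OF that]])
  have eq: "(\<lambda>x. indicator \<Omega> x *\<^sub>R (G x \<bullet> g x))
      = (\<lambda>x. \<Sum>i\<in>Basis. indicator \<Omega> x *\<^sub>R ((g x \<bullet> i) * (G x \<bullet> i)))"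
    by (rule ext, subst euclidean_inner) (simp only: scaleR_sum_right mult.commute)
  show "set_integrable lebesgue \<Omega> (\<lambda>x. G x \<bullet> g x)"
    unfolding set_integrable_def eq
    by (intro Bochner_Integration.integrable_sum I[unfolded set_integrable_def])
  have "(LINT x:\<Omega>|lebesgue. G x \<bullet> g x)
      = (\<Sum>i\<in>Basis. LINT x:\<Omega>|lebesgue. (g x \<bullet> i) * (G x \<bullet> i))"
    unfolding set_lebesgue_integral_def eq
    by (intro Bochner_Integration.integral_sum I[unfolded set_integrable_def])
  also have "\<dots> = (\<Sum>i\<in>Basis. - ((LINT x:\<Omega>|lebesgue. u x *\<^sub>R g' i x) \<bullet> i))"
  proof (rule sum.cong[OF refl])
    fix i :: 'a assume "i \<in> Basis"
    \<comment> \<open>Integrability of the vector-valued product allows the component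
      \<open>i\<close> to be taken inside its integral.\<close>
    have "set_integrable lebesgue \<Omega> (\<lambda>x. (g x \<bullet> i) *\<^sub>R G x)"
      by (rule set_integrable_componentwise) (simp add: I)
    then have "(LINT x:\<Omega>|lebesgue. (g x \<bullet> i) * (G x \<bullet> i))
        = (LINT x:\<Omega>|lebesgue. (g x \<bullet> i) *\<^sub>R G x) \<bullet> i"
      unfolding set_integrable_def set_lebesgue_integral_def
      by (subst integral_inner_left[symmetric]) (auto simp: mult.assoc)
    also have "(LINT x:\<Omega>|lebesgue. (g x \<bullet> i) *\<^sub>R G x) = - (LINT x:\<Omega>|lebesgue. u x *\<^sub>R g' i x)"
      using w t2[of i] by (simp add: weak_grad_def)
    finally show "(LINT x:\<Omega>|lebesgue. (g x \<bullet> i) * (G x \<bullet> i))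
        = - ((LINT x:\<Omega>|lebesgue. u x *\<^sub>R g' i x) \<bullet> i)" by simp
  qed
  finally show "(LINT x:\<Omega>|lebesgue. G x \<bullet> g x)
      = (\<Sum>i\<in>Basis. - ((LINT x:\<Omega>|lebesgue. u x *\<^sub>R g' i x) \<bullet> i))" .
qed

text \<open>\<open>weak_sol\<close> only asserts that some gradient exists, so the two equations may
  come with different ones; their left-hand sides agree because both equal the same expression in
  \<open>u\<close>.\<close>

lemma weak_sol_rhs_unique:
  fixes \<Omega> :: "'a::euclidean_space set"
  assumes "open \<Omega>" and s1: "weak_sol \<Omega> F1 u" and s2: "weak_sol \<Omega> F2 u"
    and t: "is_test \<Omega> \<phi> g" and t2: "\<And>i. \<exists>g'. is_test \<Omega> (\<lambda>x. g x \<bullet> i) g'"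
  shows "(LINT x:\<Omega>|lebesgue. F1 x * \<phi> x) = (LINT x:\<Omega>|lebesgue. F2 x * \<phi> x)"
proof -
  obtain g' where g': "\<And>i. is_test \<Omega> (\<lambda>x. g x \<bullet> i) (g' i)" using t2 by metis
  have "(LINT x:\<Omega>|lebesgue. F x * \<phi> x)
      = (\<Sum>i\<in>Basis. - ((LINT x:\<Omega>|lebesgue. u x *\<^sub>R g' i x) \<bullet> i)) - (LINT x:\<Omega>|lebesgue. u x * \<phi> x)"
    if sF: "weak_sol \<Omega> F u" for F
  proof -
    obtain G where G: "H01_grad \<Omega> u G" and sol:
        "(LINT x:\<Omega>|lebesgue. G x \<bullet> g x - u x * \<phi> x) = (LINT x:\<Omega>|lebesgue. F x * \<phi> x)"
      using sF t unfolding weak_sol_def by blast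
    from G have w: "weak_grad \<Omega> u G" by (simp add: H01_grad_def)
    have "set_integrable lebesgue \<Omega> (\<lambda>x. u x * \<phi> x)"
      using w by (intro L2_on_mult_integrable is_test_L2_on(1)[OF \<open>open \<Omega>\<close> t]) (simp add: weak_grad_def)
    then show ?thesis
      using weak_grad_test_integral[OF \<open>open \<Omega>\<close> w t g'] by (simp flip: sol add: set_integral_diff(2))
  qed
  from this[OF s1] this[OF s2] show ?thesis by simp
qed

text \<open>Integrability comes first, from the L3 bound and the boundedness of \<phi>; otherwise
  the integral would be 0 by default. A nonnegative integrable function with integral 0 vanishes
  almost everywhere, but this one is positive on a ball, which is not negligible.\<close>

lemma set_integral_cube_bump_pos:
  fixes \<Omega> :: "'a::euclidean_space set"
  assumes dim: "DIM('a) \<le> 3" and "open \<Omega>" and H: "H01_grad \<Omega> u G" and pos: "\<forall>x\<in>\<Omega>. u x > 0"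
    and t: "is_test \<Omega> \<phi> g" and nn: "\<And>x. \<phi> x \<ge> 0"
    and r: "r > 0" "ball x0 r \<subseteq> \<Omega>" "\<And>x. x \<in> ball x0 r \<Longrightarrow> \<phi> x > 0"
  shows "(LINT x:\<Omega>|lebesgue. (u x)^3 * \<phi> x) > 0"
proof -
  obtain B where B: "\<And>x. \<bar>\<phi> x\<bar> \<le> B"
  proof -
    let ?K = "closure {x. \<phi> x \<noteq> 0}"
    have "compact (\<phi> ` ?K)"
      using t is_testD(1)[OF t] by (intro compact_continuous_image)
        (auto simp: is_test_def intro: continuous_on_subset)
    then obtain B where B: "\<And>x. x \<in> ?K \<Longrightarrow> \<bar>\<phi> x\<bar> \<le> B"
      using compact_imp_bounded by (force simp: bounded_iff)
    have "\<bar>\<phi> x\<bar> \<le> max 0 B" for x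
    proof (cases "x \<in> ?K")
      case True then show ?thesis using B[of x] by simp
    next
      case False then have "\<phi> x = 0" by (rule is_test_zero_outside(1)[OF t])
      then show ?thesis by simp
    qed
    then show ?thesis by (rule that)
  qed
  have [measurable]: "\<phi> \<in> borel_measurable lebesgue"
    using is_testD(1)[OF t] by (intro measurable_completion) (simp add: borel_measurable_continuous_onI)
  have "set_borel_measurable lebesgue \<Omega> u"
    using H by (simp add: H01_grad_def weak_grad_def L2_on_def)
  then have [measurable]: "(\<lambda>x. indicator \<Omega> x * u x) \<in> borel_measurable lebesgue"
    by (simp add: set_borel_measurable_def)
  define f where "f x = indicator \<Omega> x *\<^sub>R ((u x)^3 * \<phi> x)" for x
  have f: "f = (\<lambda>x. (indicator \<Omega> x * u x)^3 * \<phi> x)"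
    by (rule ext) (simp add: f_def split: split_indicator)
  have f_nn: "f x \<ge> 0" for x using pos nn by (auto simp: f_def indicator_def less_imp_le)
  have int: "integrable lebesgue f"
  proof (rule Bochner_Integration.integrable_bound)
    show "integrable lebesgue (\<lambda>x. B * (indicator \<Omega> x *\<^sub>R \<bar>u x\<bar>^3))"
      using H01_grad_L3[OF dim \<open>open \<Omega>\<close> H] by (intro integrable_mult_right) (simp add: set_integrable_def)
    show "f \<in> borel_measurable lebesgue" unfolding f by measurable
    have "norm (f x) \<le> norm (B * (indicator \<Omega> x *\<^sub>R \<bar>u x\<bar>^3))" for x
    proof -
      have "norm (f x) = \<bar>\<phi> x\<bar> * (indicator \<Omega> x * \<bar>u x\<bar>^3)"
        by (simp add: f_def abs_mult power_abs)
      also have "\<dots> \<le> B * (indicator \<Omega> x * \<bar>u x\<bar>^3)" by (intro mult_right_mono B) simp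
      finally show ?thesis by simp
    qed
    then show "AE x in lebesgue. norm (f x) \<le> norm (B * (indicator \<Omega> x *\<^sub>R \<bar>u x\<bar>^3))" by simp
  qed
  have "integral\<^sup>L lebesgue f \<noteq> 0"
  proof
    assume "integral\<^sup>L lebesgue f = 0"
    then have "AE x in lebesgue. f x = 0"
      using integral_nonneg_eq_0_iff_AE[OF int] f_nn by simp
    then have "AE x in lebesgue. x \<notin> ball x0 r"
    proof eventually_elim
      fix x assume "f x = 0"
      show "x \<notin> ball x0 r"
      proof
        assume x: "x \<in> ball x0 r"
        then have "x \<in> \<Omega>" using r(2) by blast
        then have "f x > 0" using pos r(3)[OF x] by (simp add: f_def)
        then show False using \<open>f x = 0\<close> by simp
      qed
    qed
    then have "ball x0 r \<in> null_sets lebesgue"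
      by (subst (asm) AE_iff_null_sets[symmetric]) auto
    then have "negligible (ball x0 r)" by (simp add: negligible_iff_null_sets)
    then show False using r(1) by (simp add: open_not_negligible)
  qed
  moreover have "integral\<^sup>L lebesgue f \<ge> 0" by (simp add: f_nn)
  ultimately show ?thesis by (simp add: set_lebesgue_integral_def f_def[abs_def])
qed

text \<open>A bump around any point of \<Omega> tests both equations, and the positive integral of
  \<open>(u x)^3 * \<phi> x\<close> cancels.\<close>

lemma weak_sol_cube_coefficient_unique:
  fixes \<Omega> :: "'a::euclidean_space set"
  assumes dim: "DIM('a) \<le> 3" and "open \<Omega>" "\<Omega> \<noteq> {}" and pos: "\<forall>x\<in>\<Omega>. u x > 0"
    and s1: "weak_sol \<Omega> (\<lambda>x. c * (u x)^3) u" and s2: "weak_sol \<Omega> (\<lambda>x. d * (u x)^3) u"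
  shows "c = d"
proof -
  obtain x0 where "x0 \<in> \<Omega>" using \<open>\<Omega> \<noteq> {}\<close> by blast
  obtain \<phi> g r where b: "r > 0" "is_test \<Omega> \<phi> g" "\<And>i. \<exists>g'. is_test \<Omega> (\<lambda>x. g x \<bullet> i) g'"
    "\<And>x. \<phi> x \<ge> 0" "ball x0 r \<subseteq> \<Omega>" "\<And>x. x \<in> ball x0 r \<Longrightarrow> \<phi> x > 0"
    using ex_C2_bump[OF \<open>open \<Omega>\<close> \<open>x0 \<in> \<Omega>\<close>] by metis
  obtain G where G: "H01_grad \<Omega> u G" using s1 by (auto simp: weak_sol_def)
  have "c * (LINT x:\<Omega>|lebesgue. (u x)^3 * \<phi> x) = d * (LINT x:\<Omega>|lebesgue. (u x)^3 * \<phi> x)"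
    using weak_sol_rhs_unique[OF \<open>open \<Omega>\<close> s1 s2 b(2,3)] by (simp add: mult.assoc)
  moreover have "(LINT x:\<Omega>|lebesgue. (u x)^3 * \<phi> x) > 0"
    by (rule set_integral_cube_bump_pos[OF dim \<open>open \<Omega>\<close> G pos b(2,4,1,5,6)])
  ultimately show ?thesis by simp
qed

section \<open>From the elliptic system to the algebraic one\<close>

lemma synchronized_sol_iff:
  fixes \<Omega> :: "'a::euclidean_space set"
  assumes dim: "DIM('a) \<le> 3" and dom: "open \<Omega>" "\<Omega> \<noteq> {}"
    and omega_pos: "\<forall>x\<in>\<Omega>. \<omega> x > 0"
    and omega_sol: "weak_sol \<Omega> (\<lambda>x. - ((\<omega> x) ^ 3)) \<omega>"
    and pos: "\<forall>j\<in>{1..n}. \<alpha> j > 0"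
  shows "synchronized_sol \<Omega> n \<mu> \<beta> \<omega> \<alpha>
    \<longleftrightarrow> (\<forall>j\<in>{1..n}. \<mu> j * (\<alpha> j)^2 + \<beta> * (\<Sum>k\<in>{1..n}-{j}. (\<alpha> k)^2) = -1)"
proof -
  \<comment> \<open>What remains of the j-th right-hand side after splitting off
    \<open>\<alpha> j * (\<omega> x)^3\<close>; in the equation of \<omega> the corresponding
    coefficient is -1.\<close>
  define c where "c j = \<mu> j * (\<alpha> j)^2 + \<beta> * (\<Sum>k\<in>{1..n}-{j}. (\<alpha> k)^2)" for j
  have rhs: "\<mu> j * (\<alpha> j * \<omega> x)^3 + \<beta> * (\<Sum>k\<in>{1..n}-{j}. (\<alpha> k * \<omega> x)^2) * (\<alpha> j * \<omega> x)
      = c j * \<alpha> j * (\<omega> x)^3" for j x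
    unfolding c_def power_mult_distrib sum_distrib_right[symmetric]
    by (simp add: power2_eq_square power3_eq_cube algebra_simps)
  have iff: "weak_sol \<Omega> (\<lambda>x. c j * \<alpha> j * (\<omega> x)^3) (\<lambda>x. \<alpha> j * \<omega> x) \<longleftrightarrow> c j = -1"
    if j: "j \<in> {1..n}" for j
  proof
    have a: "\<alpha> j > 0" using pos j by blast
    assume "weak_sol \<Omega> (\<lambda>x. c j * \<alpha> j * (\<omega> x)^3) (\<lambda>x. \<alpha> j * \<omega> x)"
    \<comment> \<open>Scaling back by \<open>1 / \<alpha> j\<close> produces a second equation for
      \<omega> itself, to be compared with the given one.\<close>
    then have "weak_sol \<Omega> (\<lambda>x. c j * (\<omega> x)^3) (\<lambda>x. (1 / \<alpha> j) * (\<alpha> j * \<omega> x))"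
      by (rule weak_sol_scale) (use a in simp)
    then have "weak_sol \<Omega> (\<lambda>x. c j * (\<omega> x)^3) \<omega>" using a by simp
    moreover have "weak_sol \<Omega> (\<lambda>x. - 1 * (\<omega> x)^3) \<omega>" using omega_sol by simp
    ultimately show "c j = -1"
      by (rule weak_sol_cube_coefficient_unique[OF dim dom omega_pos])
  next
    assume "c j = -1"
    then show "weak_sol \<Omega> (\<lambda>x. c j * \<alpha> j * (\<omega> x)^3) (\<lambda>x. \<alpha> j * \<omega> x)"
      by (intro weak_sol_scale[OF omega_sol]) simp
  qed
  have "\<alpha> j * \<omega> x > 0" if "j \<in> {1..n}" "x \<in> \<Omega>" for j x using pos omega_pos that by simp
  then show ?thesis
    unfolding synchronized_sol_def sys_solution_def rhs using iff pos by (auto simp: c_def)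
qed

theorem theorem1p1:
  fixes \<Omega> :: "'a::euclidean_space set" and \<omega> :: "'a \<Rightarrow> real"
    and n :: nat and \<mu> :: "nat \<Rightarrow> real"
  assumes dim: "DIM('a) \<le> 3"
    and dom: "open \<Omega>" "connected \<Omega>" "bounded \<Omega>" "\<Omega> \<noteq> {}"
    and lam: "dirichlet_lambda1 \<Omega> < 1"
    and n3: "n \<ge> 3"
    and mu_sorted: "\<And>i j. 1 \<le> i \<Longrightarrow> i \<le> j \<Longrightarrow> j \<le> n \<Longrightarrow> \<mu> i \<le> \<mu> j"
    and omega_pos: "\<forall>x\<in>\<Omega>. \<omega> x > 0"
    and omega_sol: "weak_sol \<Omega> (\<lambda>x. - ((\<omega> x) ^ 3)) \<omega>"
  shows "\<forall>\<beta>\<in>I_set n \<mu>.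
           (\<forall>j\<in>{1..n}. (\<beta> - \<mu> j) * gfun n \<mu> \<beta> > 0)
         \<and> synchronized_sol \<Omega> n \<mu> \<beta> \<omega> (alpha_branch n \<mu> \<beta>)
         \<and> (\<forall>\<alpha>. synchronized_sol \<Omega> n \<mu> \<beta> \<omega> \<alpha> \<longrightarrow> (\<forall>j\<in>{1..n}. \<alpha> j = alpha_branch n \<mu> \<beta> j))"
proof
  fix \<beta> assume \<beta>: "\<beta> \<in> I_set n \<mu>"
  have sgn: "(\<beta> - \<mu> j) * gfun n \<mu> \<beta> > 0" if "j \<in> {1..n}" for j
    by (rule I_set_sign[OF _ mu_sorted \<beta> that]) (use n3 in auto)
  \<comment> \<open>The sign condition also excludes zeros of g and coincidences of \<beta> with
    some \<open>\<mu> j\<close>, as the linear system requires.\<close>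
  have g: "gfun n \<mu> \<beta> \<noteq> 0" using sgn[of 1] n3 by auto
  have ne: "\<beta> \<noteq> \<mu> j" if "j \<in> {1..n}" for j using sgn[OF that] by auto
  note br = alpha_branch_square[OF sgn]
  have iff: "synchronized_sol \<Omega> n \<mu> \<beta> \<omega> \<alpha>
      \<longleftrightarrow> (\<forall>j\<in>{1..n}. (\<alpha> j)^2 = 1 / ((\<beta> - \<mu> j) * gfun n \<mu> \<beta>))"
    if "\<forall>j\<in>{1..n}. \<alpha> j > 0" for \<alpha>
    by (rule trans[OF synchronized_sol_iff[OF dim dom(1,4) omega_pos omega_sol that]
          synchronized_system_iff[OF g ne]])
  show "(\<forall>j\<in>{1..n}. (\<beta> - \<mu> j) * gfun n \<mu> \<beta> > 0)
     \<and> synchronized_sol \<Omega> n \<mu> \<beta> \<omega> (alpha_branch n \<mu> \<beta>)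
     \<and> (\<forall>\<alpha>. synchronized_sol \<Omega> n \<mu> \<beta> \<omega> \<alpha> \<longrightarrow> (\<forall>j\<in>{1..n}. \<alpha> j = alpha_branch n \<mu> \<beta> j))"
  proof (intro conjI ballI allI impI)
    show "synchronized_sol \<Omega> n \<mu> \<beta> \<omega> (alpha_branch n \<mu> \<beta>)"
      by (rule iff[THEN iffD2]) (use br in simp_all)
    fix \<alpha> j assume s: "synchronized_sol \<Omega> n \<mu> \<beta> \<omega> \<alpha>" and j: "j \<in> {1..n}"
    then have pos: "\<forall>j\<in>{1..n}. \<alpha> j > 0" by (simp add: synchronized_sol_def)
    have "(\<alpha> j)^2 = (alpha_branch n \<mu> \<beta> j)^2"
      using iff[OF pos] s j br(1)[OF j] by simp
    \<comment> \<open>Equal squares leave two signs; positivity of both amplitudes selects the same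
      root.\<close>
    then show "\<alpha> j = alpha_branch n \<mu> \<beta> j"
      by (rule power2_eq_imp_eq) (use pos j br(2)[OF j] in \<open>simp_all add: less_imp_le\<close>)
  qed (rule sgn)
qed

end
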